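(* Let $\alpha$ be an integer with $-\alpha\in\mathbb N=\{1,2,3,\dots\}$, and let $m,n\in\mathbb N_0$ be such that $|\alpha|>n$ and $m\geq n$. Then $$\mathrm{gen}\!\int_0^\infty L_m^\alpha(z)\,L_n^\alpha(z)\,z^\alpha e^{-z}\,dz=\frac{(-1)^{\alpha+n}}{n!\,(|\alpha|-n-1)!\,(m-n)}\qquad\text{if } n<m,$$ and $$\mathrm{gen}\!\int_0^\infty L_n^\alpha(z)^2\,z^\alpha e^{-z}\,dz=\frac{(-1)^{\alpha+n+1}}{n!\,(|\alpha|-n-1)!}\,\psi(|\alpha|-n).$$
   Context: Laguerre polynomials: for $\alpha\in\mathbb C$ and $n\in\mathbb N_0$, $$L_n^\alpha(z):=\frac1{n!}e^zz^{-\alpha}\partial_z^n\big(e^{-z}z^{n+\alpha}\big)=(-1)^n\sum_{k=0}^n\frac{(-\alpha-n)_{n-k}\,z^k}{k!\,(n-k)!},$$ where $(a)_k=a(a+1)\cdots(a+k-1)$. $\psi=\Gamma'/\Gamma$ is the digamma function. Generalized integral: a function $f$ on $]0,\infty[$ is integrable in the generalized sense if it is integrable on $]1,\infty[$ and there exist a finite set $\Omega\subset\mathbb C$ and complex coefficients $(f_k)_{k\in\Omega}$ such that $f-\sum_{k\in\Omega}f_kr^k$ is integrable on $]0,1[$. For such $f$, $$\mathrm{gen}\!\int_0^\infty f(r)\,dr:=\sum_{k\in\Omega\setminus\{-1\}}\frac{f_k}{k+1}+\int_0^1\Big(f(r)-\sum_{k\in\Omega}f_kr^k\Big)dr+\int_1^\infty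 f(r)\,dr,$$ which does not depend on the choice of $\Omega$. *)

theory Defs
  imports "HOL-Complex_Analysis.Complex_Analysis"
begin

definition laguerre :: "complex \<Rightarrow> nat \<Rightarrow> complex \<Rightarrow> complex" where
  "laguerre \<alpha> n z =
     (-1) ^ n * (\<Sum>k\<le>n. pochhammer (- \<alpha> - of_nat n) (n - k) * z ^ k / (fact k * fact (n - k)))"

lemma higher_deriv_exp_minus:
  "(deriv ^^ i) (\<lambda>w. exp (- w)) = (\<lambda>z::complex. (-1) ^ i * exp (- z))"
proof (induction i)
  case (Suc i)
  have "((\<lambda>w. (-1) ^ i * exp (- w)) has_field_derivative (-1) ^ Suc i * exp (- z)) (at z)" for z :: complex
    by (auto intro!: derivative_eq_intros)
  then show ?case
    by (simp add: Suc DERIV_imp_deriv fun_eq_iff)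
qed simp

lemma higher_deriv_powr:
  fixes \<beta> z :: complex
  assumes "z \<notin> \<real>\<^sub>\<le>\<^sub>0"
  shows "(deriv ^^ j) (\<lambda>w. w powr \<beta>) z = (-1) ^ j * pochhammer (- \<beta>) j * z powr (\<beta> - of_nat j)"
  using assms
proof (induction j arbitrary: z)
  case (Suc j)
  let ?c = "(-1) ^ j * pochhammer (- \<beta>) j"
  have op: "open (- \<real>\<^sub>\<le>\<^sub>0 :: complex set)"
    by (simp add: open_Compl closed_nonpos_Reals_complex)
  have "((\<lambda>w. ?c * w powr (\<beta> - of_nat j)) has_field_derivative
      (-1) ^ Suc j * pochhammer (- \<beta>) (Suc j) * z powr (\<beta> - of_nat (Suc j))) (at z)"
    using Suc.prems
    by (auto intro!: derivative_eq_intros simp: pochhammer_Suc algebra_simps)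
  then have "((deriv ^^ j) (\<lambda>w. w powr \<beta>) has_field_derivative
      (-1) ^ Suc j * pochhammer (- \<beta>) (Suc j) * z powr (\<beta> - of_nat (Suc j))) (at z)"
    by (rule has_field_derivative_transform_within_open[OF _ op]) (use Suc in auto)
  then show ?case
    by (simp add: DERIV_imp_deriv)
qed simp

text \<open>On the negative real axis and at the origin the right-hand side below depends on the branch
  of the power function, which is why the polynomial is taken as the definition.\<close>

lemma laguerre_rodrigues:
  assumes "z \<notin> \<real>\<^sub>\<le>\<^sub>0"
  shows "laguerre \<alpha> n z =
     exp z * z powr (- \<alpha>) / fact n * (deriv ^^ n) (\<lambda>w. exp (- w) * w powr (of_nat n + \<alpha>)) z"
proof -
  have op: "open (- \<real>\<^sub>\<le>\<^sub>0 :: complex set)"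
    by (simp add: open_Compl closed_nonpos_Reals_complex)
  have rearrange: "E * Z / F * (F / G * (s * e) * (t * P * (y * Z'))) = (E * e) * (Z * Z') * (s * t) * (P * y / G)"
    if "F \<noteq> 0" for E Z F G s e t P y Z' :: complex
    using that by simp
  have z0: "z \<noteq> 0" using assms by auto
  have "(deriv ^^ n) (\<lambda>w. exp (- w) * w powr (of_nat n + \<alpha>)) z =
     (\<Sum>k = 0..n. of_nat (n choose k) * (deriv ^^ k) (\<lambda>w. exp (- w)) z
        * (deriv ^^ (n - k)) (\<lambda>w. w powr (of_nat n + \<alpha>)) z)"
    by (rule higher_deriv_mult[OF _ _ op])
       (use assms in \<open>auto intro!: holomorphic_intros\<close>)
  also have "\<dots> = (\<Sum>k = 0..n. of_nat (n choose k) * ((-1) ^ k * exp (- z)) *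
      ((-1) ^ (n - k) * pochhammer (- \<alpha> - of_nat n) (n - k) * z powr (of_nat k + \<alpha>)))"
  proof (intro sum.cong refl)
    fix k assume "k \<in> {0..n}"
    then have e: "of_nat n + \<alpha> - of_nat (n - k) = of_nat k + \<alpha>"
      and e': "- (of_nat n + \<alpha>) = - \<alpha> - of_nat n"
      by (simp_all add: of_nat_diff)
    show "of_nat (n choose k) * (deriv ^^ k) (\<lambda>w. exp (- w)) z
        * (deriv ^^ (n - k)) (\<lambda>w. w powr (of_nat n + \<alpha>)) z =
      of_nat (n choose k) * ((-1) ^ k * exp (- z)) *
      ((-1) ^ (n - k) * pochhammer (- \<alpha> - of_nat n) (n - k) * z powr (of_nat k + \<alpha>))"
      unfolding higher_deriv_exp_minus higher_deriv_powr[OF assms] e e' ..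
  qed
  finally have D: "(deriv ^^ n) (\<lambda>w. exp (- w) * w powr (of_nat n + \<alpha>)) z =
     (\<Sum>k = 0..n. of_nat (n choose k) * ((-1) ^ k * exp (- z)) *
      ((-1) ^ (n - k) * pochhammer (- \<alpha> - of_nat n) (n - k) * z powr (of_nat k + \<alpha>)))" .
  have "exp z * z powr (- \<alpha>) / fact n * (deriv ^^ n) (\<lambda>w. exp (- w) * w powr (of_nat n + \<alpha>)) z =
      (\<Sum>k = 0..n. (-1) ^ n * (pochhammer (- \<alpha> - of_nat n) (n - k) * z ^ k / (fact k * fact (n - k))))"
    unfolding D sum_distrib_left
  proof (intro sum.cong refl)
    fix k assume "k \<in> {0..n}"
    then have k: "k \<le> n" by simp
    have b: "of_nat (n choose k) = (fact n / (fact k * fact (n - k)) :: complex)"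
      by (rule binomial_fact[OF k])
    have p: "z powr (of_nat k + \<alpha>) = z ^ k * z powr \<alpha>"
      using z0 by (simp add: powr_add powr_nat')
    have q: "z powr (- \<alpha>) * z powr \<alpha> = 1" "exp z * exp (- z) = 1"
      using z0 by (simp_all add: powr_minus exp_minus)
    have s: "(-1) ^ k * (-1) ^ (n - k) = ((-1) ^ n :: complex)"
      using k by (simp flip: power_add)
    have "exp z * z powr (- \<alpha>) / fact n * (of_nat (n choose k) * ((-1) ^ k * exp (- z)) *
      ((-1) ^ (n - k) * pochhammer (- \<alpha> - of_nat n) (n - k) * z powr (of_nat k + \<alpha>)))
      = (exp z * exp (- z)) * (z powr (- \<alpha>) * z powr \<alpha>) * ((-1) ^ k * (-1) ^ (n - k)) * 
        (pochhammer (- \<alpha> - of_nat n) (n - k) * z ^ k / (fact k * fact (n - k)))"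
      unfolding b p by (rule rearrange) simp
    then show "exp z * z powr (- \<alpha>) / fact n * (of_nat (n choose k) * ((-1) ^ k * exp (- z)) *
      ((-1) ^ (n - k) * pochhammer (- \<alpha> - of_nat n) (n - k) * z powr (of_nat k + \<alpha>)))
      = (-1) ^ n * (pochhammer (- \<alpha> - of_nat n) (n - k) * z ^ k / (fact k * fact (n - k)))"
      by (simp only: q s) simp
  qed
  then show ?thesis
    unfolding laguerre_def sum_distrib_left atLeast0AtMost by (rule sym)
qed

definition gen_expansion :: "(real \<Rightarrow> complex) \<Rightarrow> complex set \<Rightarrow> (complex \<Rightarrow> complex) \<Rightarrow> bool" where
  "gen_expansion f \<Omega> c \<longleftrightarrow>
     finite \<Omega> \<and>
     f absolutely_integrable_on {1<..} \<and>
     (\<lambda>r. f r - (\<Sum>k\<in>\<Omega>. c k * of_real r powr k)) absolutely_integrable_on {0<..<1}"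

definition gen_integrable :: "(real \<Rightarrow> complex) \<Rightarrow> bool" where
  "gen_integrable f \<longleftrightarrow> (\<exists>\<Omega> c. gen_expansion f \<Omega> c)"

definition gen_value :: "(real \<Rightarrow> complex) \<Rightarrow> complex set \<Rightarrow> (complex \<Rightarrow> complex) \<Rightarrow> complex" where
  "gen_value f \<Omega> c =
     (\<Sum>k\<in>\<Omega> - {-1}. c k / (k + 1))
     + (LINT r:{0<..<1}|lebesgue. f r - (\<Sum>k\<in>\<Omega>. c k * of_real r powr k))
     + (LINT r:{1<..}|lebesgue. f r)"

text \<open>The value is the same for every expansion of a function that is integrable in the generalized
  sense; otherwise the description below is meaningless.\<close>

definition gen_integral :: "(real \<Rightarrow> complex) \<Rightarrow> complex" where
  "gen_integral f = (THE I. \<exists>\<Omega> c. gen_expansion f \<Omega> c \<and> I = gen_value f \<Omega> c)"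

definition laguerre_integrand :: "int \<Rightarrow> nat \<Rightarrow> nat \<Rightarrow> real \<Rightarrow> complex" where
  "laguerre_integrand \<alpha> m n z =
     laguerre (of_int \<alpha>) m (of_real z) * laguerre (of_int \<alpha>) n (of_real z)
       * of_real (z powi \<alpha> * exp (- z))"

end

(*
  The generalized integral is a Hadamard finite part: the integral of f over [d, oo) plus a
  combination of ln d and of powers of d with nonzero exponents tends to it as d -> 0.
  The finite part is well defined because a combination of ln d, nonconstant powers and a
  constant can tend to 0 only if its constant term vanishes.

  The finite part of r^s exp(-r) for an integer s is the constant term of the Laurent expansion
  of Gamma at s + 1. For s = -1 this is the limit of Gamma(e) - 1/e as e -> 0, and integration by
  parts reaches the other integers. Vandermonde's identity turns the sum over the coefficients
  of the Laguerre polynomial of degree m into the polynomial (alpha - x)_m / m!, which acts on the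
  pole part through its derivative. At x = alpha + j with j <= n it vanishes unless j = m = n, so only
  residues of Gamma survive when n < m, and one value of the digamma function is added when n = m.
*)
theory Submission
  imports Defs
begin

subsection \<open>Regularized values of the Gamma function at the integers\<close>

text \<open>The Laurent expansion of the Gamma function at \<open>s + 1\<close> is
  \<open>\<Gamma>(s + 1 + \<epsilon>) = gamma_res s / \<epsilon> + gamma_fp s + O(\<epsilon>)\<close>.\<close>

definition gamma_res :: "int \<Rightarrow> complex" where
  "gamma_res s = (if s < 0 then (-1) ^ nat (- s - 1) / fact (nat (- s - 1)) else 0)"

definition gamma_fp :: "int \<Rightarrow> complex" where
  "gamma_fp s = (if s < 0 then gamma_res s * Digamma (of_int (- s)) else fact (nat s))"

lemma gamma_res_neg: "gamma_res (- 1 - int q) = (-1) ^ q / fact q"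
  by (simp add: gamma_res_def)

lemma gamma_fp_neg: "gamma_fp (- 1 - int q) = (-1) ^ q / fact q * Digamma (of_nat (Suc q))"
  by (simp add: gamma_fp_def gamma_res_neg add.commute)

text \<open>Comparison of the coefficients of 1/eps in Gamma(s + 2 + eps) = (s + 1 + eps) Gamma(s +
  1 + eps).\<close>

lemma gamma_res_rec: "gamma_res (s + 1) = of_int (s + 1) * gamma_res s"
proof (cases "s < - 1")
  case True
  define q where "q = nat (- s - 2)"
  have s: "s = - 1 - int (Suc q)" "s + 1 = - 1 - int q" using True by (auto simp: q_def)
  obtain N :: complex where N: "N \<noteq> 0" "of_int (- 1 - int q) = - N" "fact (Suc q) = N * fact q"
    by (rule that[of "of_nat (Suc q)", OF of_nat_neq_0 _ fact_Suc]) simp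
  show ?thesis
    unfolding s(2) unfolding s(1) gamma_res_neg N using N(1) by (simp add: field_simps)
next
  case False
  then show ?thesis by (cases "s = - 1") (auto simp: gamma_res_def)
qed

text \<open>Comparison of the constant coefficients in the same functional equation; the extra
  residue is the product of eps with the pole part.\<close>

lemma gamma_fp_rec: "gamma_fp (s + 1) = of_int (s + 1) * gamma_fp s + gamma_res s"
proof -
  consider "s < - 1" | "s = - 1" | "s \<ge> 0" by linarith
  then show ?thesis
  proof cases
    case 1
    define q where "q = nat (- s - 2)"
    have s: "s = - 1 - int (Suc q)" "s + 1 = - 1 - int q" using 1 by (auto simp: q_def)
    obtain N :: complex where N: "N \<noteq> 0" "of_int (- 1 - int q) = - N" "fact (Suc q) = N * fact q"
      "of_nat (Suc q) = N" "of_nat (Suc (Suc q)) = N + 1"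
      by (rule that[of "of_nat (Suc q)", OF of_nat_neq_0 _ fact_Suc]) simp_all
    show ?thesis
      unfolding s(2) unfolding s(1) gamma_fp_neg gamma_res_neg N Digamma_plus1[OF N(1)]
      using N(1) by (simp add: field_simps)
  next
    case 2
    then show ?thesis by (simp add: gamma_fp_def gamma_res_def)
  next
    case 3
    then show ?thesis by (simp add: gamma_fp_def gamma_res_def nat_add_distrib)
  qed
qed

section \<open>Derivatives of the rising factorial in its base\<close>

definition pochhammer_deriv :: "nat \<Rightarrow> complex \<Rightarrow> complex" where
  "pochhammer_deriv n = deriv (\<lambda>y. pochhammer y n)"

lemma has_field_derivative_pochhammer:
  "((\<lambda>y. pochhammer y n) has_field_derivative pochhammer_deriv n z) (at z)"
  unfolding pochhammer_deriv_def
  by (rule holomorphic_derivI[of _ UNIV]) (auto intro!: holomorphic_intros)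

lemma pochhammer_deriv_eqI:
  "((\<lambda>y. pochhammer y n) has_field_derivative D) (at z) \<Longrightarrow> pochhammer_deriv n z = D"
  by (rule DERIV_unique[OF has_field_derivative_pochhammer])

lemma pochhammer_deriv_0 [simp]: "pochhammer_deriv 0 z = 0"
  by (rule pochhammer_deriv_eqI) simp

lemma pochhammer_deriv_Suc:
  "pochhammer_deriv (Suc n) z = pochhammer_deriv n z * (z + of_nat n) + pochhammer z n"
  by (rule pochhammer_deriv_eqI, unfold pochhammer_Suc)
     (auto intro!: derivative_eq_intros has_field_derivative_pochhammer)

text \<open>Constant coefficient of Gamma(s + 1 + i + eps) = (s + 1 + eps)_i Gamma(s + 1 + eps): the
  linear term of the polynomial factor meets the pole, so the derivative of the rising factorial
  enters.\<close>

lemma gamma_fp_add: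
  "gamma_fp (s + int i) = pochhammer (of_int s + 1) i * gamma_fp s
     + pochhammer_deriv i (of_int s + 1) * gamma_res s"
proof -
  have res: "gamma_res (s + int i) = pochhammer (of_int s + 1) i * gamma_res s" for i
  proof (induction i)
    case (Suc i)
    then show ?case
      using gamma_res_rec[of "s + int i"] by (simp add: pochhammer_Suc algebra_simps)
  qed simp
  show ?thesis
  proof (induction i)
    case (Suc i)
    then show ?case
      using gamma_fp_rec[of "s + int i"] res[of i]
      by (simp add: pochhammer_Suc pochhammer_deriv_Suc algebra_simps)
  qed simp
qed

text \<open>The polynomial (y)_m has a simple zero at -j, so its derivative there is the product of
  the remaining factors: (-j)...(-1) below the zero and 1...(m - 1 - j) above it.\<close>

lemma pochhammer_deriv_minus_of_nat:
  assumes "j < m"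
  shows "pochhammer_deriv m (- of_nat j :: complex) = (-1) ^ j * fact j * fact (m - 1 - j)"
proof -
  define h where "h y = pochhammer y j * pochhammer (y + of_nat j + 1) (m - 1 - j)" for y :: complex
  have m: "m = j + Suc (m - 1 - j)" using assms by simp
  have eq: "pochhammer y m = (y + of_nat j) * h y" for y :: complex
    unfolding h_def by (subst m) (simp only: pochhammer_product' pochhammer_rec, simp add: mult_ac)
  have "h holomorphic_on UNIV" unfolding h_def[abs_def] by (auto intro!: holomorphic_intros)
  then have "(h has_field_derivative deriv h (- of_nat j)) (at (- of_nat j))"
    by (rule holomorphic_derivI) auto
  then have "((\<lambda>y. (y + of_nat j) * h y) has_field_derivative h (- of_nat j)) (at (- of_nat j))"
    by (auto intro!: derivative_eq_intros)
  then have "pochhammer_deriv m (- of_nat j :: complex) = h (- of_nat j)"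
    unfolding eq[symmetric] by (rule pochhammer_deriv_eqI)
  also have "\<dots> = (-1) ^ j * fact j * fact (m - 1 - j)"
    by (simp add: h_def pochhammer_same pochhammer_fact)
  finally show ?thesis .
qed

text \<open>No factor of (y)_n vanishes at -n, so the logarithmic derivative applies: (-n)_n =
  (-1)^n n! times the sum of the 1/(i - n), which is minus the harmonic number.\<close>

lemma pochhammer_deriv_minus_same:
  "pochhammer_deriv n (- of_nat n :: complex) = - ((-1) ^ n * fact n * harm n)"
proof -
  have *: "pochhammer_deriv k z = pochhammer z k * (\<Sum>i<k. 1 / (z + of_nat i))"
    if "\<And>i. i < k \<Longrightarrow> z + of_nat i \<noteq> 0" for k and z :: complex
    using that
  proof (induction k)
    case (Suc k)
    then have "z + of_nat k \<noteq> 0" "pochhammer_deriv k z = pochhammer z k * (\<Sum>i<k. 1 / (z + of_nat i))"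
      by auto
    then show ?case
      by (simp only: pochhammer_deriv_Suc pochhammer_Suc sum.lessThan_Suc distrib_left[of "_ * _"])
        (simp add: field_simps)
  qed simp
  have nz: "- of_nat n + of_nat i \<noteq> (0 :: complex)" if "i < n" for i
    using that by (metis add.commute add_right_cancel diff_add_cancel diff_zero neg_eq_iff_add_eq_0 nat_neq_iff of_nat_eq_iff uminus_add_conv_diff)
  have "(\<Sum>i<n. 1 / (- of_nat n + of_nat i)) = (\<Sum>i<n. - inverse (of_nat (Suc (n - Suc i)) :: complex))"
  proof (rule sum.cong[OF refl])
    fix i assume "i \<in> {..<n}"
    then have "Suc (n - Suc i) = n - i" "i \<le> n" by auto
    then show "1 / (- of_nat n + of_nat i) = - inverse (of_nat (Suc (n - Suc i)) :: complex)"
      using nz[of i] \<open>i \<in> _\<close> by (simp only: of_nat_diff) (simp add: field_simps)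
  qed
  also have "\<dots> = (\<Sum>i<n. - inverse (of_nat (Suc i)))"
    by (rule sum.nat_diff_reindex)
  also have "\<dots> = - harm n"
    by (simp add: harm_def sum_negf sum.atLeast1_atMost_eq del: atLeast1_atMost_eq_remove0)
  finally show ?thesis
    using *[of n "- of_nat n"] nz by (simp add: pochhammer_same)
qed

subsection \<open>The bilinear form on Laguerre coefficients\<close>

definition laguerre_coeff :: "complex \<Rightarrow> nat \<Rightarrow> nat \<Rightarrow> complex" where
  "laguerre_coeff \<alpha> n k = (-1) ^ n * pochhammer (- \<alpha> - of_nat n) (n - k) / (fact k * fact (n - k))"

lemma laguerre_eq_sum: "laguerre \<alpha> n z = (\<Sum>k\<le>n. laguerre_coeff \<alpha> n k * z ^ k)"
  by (simp add: laguerre_def laguerre_coeff_def sum_distrib_left mult.assoc)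

text \<open>For Re x > -1, \<open>pochhammer (x + 1) i\<close> is Gamma(x + 1 + i) / Gamma(x + 1),
  so the sum is a normalized moment of the Laguerre polynomial against z^x e^-z. The factorials in
  the coefficients form binomials, which makes it Vandermonde's convolution.\<close>

lemma sum_laguerre_coeff_pochhammer:
  "(\<Sum>i\<le>m. laguerre_coeff \<alpha> m i * pochhammer (x + 1) i) = pochhammer (\<alpha> - x) m / fact m"
proof -
  have "(\<Sum>i\<le>m. laguerre_coeff \<alpha> m i * pochhammer (x + 1) i) =
     (-1) ^ m / fact m * (\<Sum>i\<le>m. of_nat (m choose i) * pochhammer (x + 1) i * pochhammer (- \<alpha> - of_nat m) (m - i))"
    unfolding sum_distrib_left
    by (intro sum.cong refl) (simp add: laguerre_coeff_def binomial_fact)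
  also have "\<dots> = (-1) ^ m / fact m * pochhammer (x + 1 + (- \<alpha> - of_nat m)) m"
    by (simp only: pochhammer_binomial_sum)
  \<comment> \<open>Negating all m factors absorbs (-1)^m and reverses their order.\<close>
  also have "\<dots> = pochhammer (\<alpha> - x) m / fact m"
    using pochhammer_minus[of "x - \<alpha>" m] by (simp add: algebra_simps)
  finally show ?thesis .
qed

text \<open>The preceding identity holds for every x, so it may be differentiated in x; the minus
  sign comes from the argument \<alpha> - x.\<close>

lemma sum_laguerre_coeff_pochhammer_deriv:
  "(\<Sum>i\<le>m. laguerre_coeff \<alpha> m i * pochhammer_deriv i (x + 1)) =
     - pochhammer_deriv m (\<alpha> - x) / fact m"
proof -
  have chain: "((\<lambda>t. pochhammer (u + c * t) i) has_field_derivative pochhammer_deriv i (u + c * x) * c) (at x)"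
    for u c i
    by (rule DERIV_chain2[OF has_field_derivative_pochhammer]) (auto intro!: derivative_eq_intros)
  have "((\<lambda>t. \<Sum>i\<le>m. laguerre_coeff \<alpha> m i * pochhammer (t + 1) i) has_field_derivative
      (\<Sum>i\<le>m. laguerre_coeff \<alpha> m i * pochhammer_deriv i (x + 1))) (at x)"
    using chain[of 1 1] by (intro DERIV_sum DERIV_cmult) (simp add: add.commute)
  moreover have "((\<lambda>t. pochhammer (\<alpha> - t) m / fact m) has_field_derivative
      - pochhammer_deriv m (\<alpha> - x) / fact m) (at x)"
    using DERIV_cdivide[OF chain[of \<alpha> "- 1"]] by simp
  ultimately show ?thesis
    unfolding sum_laguerre_coeff_pochhammer by (rule DERIV_unique)
qed

text \<open>This evaluates the finite part of the integral of L_m^\<alpha>(z) z^s e^-z: the two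
  preceding sums give the factors of the constant and the pole part of Gamma at s + 1.\<close>

lemma sum_laguerre_coeff_gamma_fp:
  "(\<Sum>i\<le>m. laguerre_coeff \<alpha> m i * gamma_fp (s + int i)) =
     (pochhammer (\<alpha> - of_int s) m * gamma_fp s - pochhammer_deriv m (\<alpha> - of_int s) * gamma_res s) / fact m"
proof -
  have "(\<Sum>i\<le>m. laguerre_coeff \<alpha> m i * gamma_fp (s + int i)) =
     (\<Sum>i\<le>m. laguerre_coeff \<alpha> m i * pochhammer (of_int s + 1) i) * gamma_fp s +
     (\<Sum>i\<le>m. laguerre_coeff \<alpha> m i * pochhammer_deriv i (of_int s + 1)) * gamma_res s"
    by (simp add: gamma_fp_add distrib_left sum.distrib sum_distrib_right mult.assoc)
  then show ?thesis
    by (simp add: sum_laguerre_coeff_pochhammer sum_laguerre_coeff_pochhammer_deriv diff_divide_distrib)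
qed

text \<open>The value obtained by expanding both polynomials and replacing each integral of z^s e^-z
  by its regularization \<open>gamma_fp s\<close>.\<close>

definition laguerre_pairing :: "int \<Rightarrow> nat \<Rightarrow> nat \<Rightarrow> complex" where
  "laguerre_pairing \<alpha> m n = (\<Sum>j\<le>n. \<Sum>i\<le>m. laguerre_coeff (of_int \<alpha>) n j * laguerre_coeff (of_int \<alpha>) m i
      * gamma_fp (\<alpha> + int j + int i))"

text \<open>The inner sum is taken at s = \<alpha> + j, so \<alpha> - s becomes -j, a zero of the
  rising factorial of length m whenever j < m.\<close>

lemma laguerre_pairing_eq:
  "laguerre_pairing \<alpha> m n = (\<Sum>j\<le>n. laguerre_coeff (of_int \<alpha>) n j *
     ((pochhammer (- of_nat j) m * gamma_fp (\<alpha> + int j)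
        - pochhammer_deriv m (- of_nat j) * gamma_res (\<alpha> + int j)) / fact m))"
  unfolding laguerre_pairing_def
  by (simp add: mult.assoc sum_laguerre_coeff_gamma_fp flip: sum_distrib_left)

text \<open>The coefficient contains (A - n)_(n-j) = (A - 1 - j)! / (A - n - 1)!, and its numerator
  cancels the factorial in the residue.\<close>

lemma laguerre_coeff_gamma_res:
  assumes "n < A" "j \<le> n"
  shows "laguerre_coeff (- of_nat A) n j * gamma_res (- int A + int j) =
    (-1) ^ (n + A + j + 1) / (fact j * fact (n - j) * fact (A - n - 1))"
proof -
  have s: "- int A + int j = - 1 - int (A - 1 - j)" using assms by auto
  have "pochhammer (of_nat (Suc (A - n - 1))) (n - j) = (fact (A - n - 1 + (n - j)) / fact (A - n - 1) :: complex)"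
    using pochhammer_fact pochhammer_product'[of "1 :: complex" "A - n - 1" "n - j"]
    by (simp add: field_simps flip: pochhammer_fact)
  moreover have "A - n - 1 + (n - j) = A - 1 - j" using assms by auto
  moreover have "of_nat (Suc (A - n - 1)) = (of_nat A - of_nat n :: complex)"
    using assms by (simp add: Suc_diff_Suc of_nat_diff del: of_nat_Suc)
  ultimately have p: "pochhammer (of_nat A - of_nat n) (n - j) = (fact (A - 1 - j) / fact (A - n - 1) :: complex)"
    by simp
  have "(-1) ^ (n + A + j + 1) = ((-1) ^ (n + (A - 1 - j)) :: complex)"
  proof -
    have "n + A + j + 1 = n + (A - 1 - j) + 2 * (j + 1)" using assms by auto
    then show ?thesis by (simp only: power_add power_mult) simp
  qed
  then show ?thesis
    unfolding s gamma_res_neg laguerre_coeff_def by (simp add: p power_add field_simps)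
qed

text \<open>Each quotient is (m - 1 - n)! times the binomial of m - 1 - j over n - j; these
  binomials lie on a diagonal of Pascal's triangle and add up to m over n.\<close>

lemma sum_fact_div_fact:
  assumes "n < m"
  shows "(\<Sum>j\<le>n. fact (m - 1 - j) / fact (n - j)) = (fact m / (fact n * (of_nat m - of_nat n)) :: complex)"
proof -
  have "(\<Sum>j\<le>n. fact (m - 1 - j) / fact (n - j)) = (\<Sum>j\<le>n. fact (m - 1 - n) * of_nat ((m - 1 - j) choose (n - j)) :: complex)"
    using assms by (intro sum.cong refl) (auto simp: binomial_fact field_simps)
  also have "\<dots> = fact (m - 1 - n) * of_nat (\<Sum>j\<le>n. (m - 1 - j) choose (n - j))"
    by (simp add: sum_distrib_left)
  also have "(\<Sum>j\<le>n. (m - 1 - j) choose (n - j)) = m choose n"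
    using sum_choose_diagonal[of n "m - 1"] assms by simp
  also have "of_nat (m choose n) = (fact m / (fact n * fact (m - n)) :: complex)"
    using assms by (intro binomial_fact) auto
  also have "fact (m - n) = (of_nat m - of_nat n) * (fact (m - 1 - n) :: complex)"
    using fact_reduce[of "m - n", where 'a=complex] assms by (simp add: of_nat_diff diff_right_commute)
  finally show ?thesis by simp
qed

text \<open>As (-j)_m = 0, only derivative times residue survives, and there both (-1)^j and j!
  cancel. The case m = n, j < n is included and serves the diagonal evaluation.\<close>

lemma laguerre_pairing_term:
  assumes "n < A" "j \<le> n" "j < m"
  shows "laguerre_coeff (- of_nat A) n j *
     ((pochhammer (- of_nat j) m * gamma_fp (- int A + int j)
        - pochhammer_deriv m (- of_nat j) * gamma_res (- int A + int j)) / fact m) =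
    (-1) ^ (A + n) / (fact m * fact (A - n - 1)) * (fact (m - 1 - j) / fact (n - j))"
proof -
  have "pochhammer (- of_nat j) m = (0 :: complex)"
    using assms by (simp add: pochhammer_of_nat_eq_0_iff)
  then have "laguerre_coeff (- of_nat A) n j *
     ((pochhammer (- of_nat j) m * gamma_fp (- int A + int j)
        - pochhammer_deriv m (- of_nat j) * gamma_res (- int A + int j)) / fact m) =
    - (laguerre_coeff (- of_nat A) n j * gamma_res (- int A + int j)) * pochhammer_deriv m (- of_nat j) / fact m"
    by simp
  also have "\<dots> = (-1) ^ (A + n) / (fact m * fact (A - n - 1)) * (fact (m - 1 - j) / fact (n - j))"
    unfolding laguerre_coeff_gamma_res[OF assms(1,2)] pochhammer_deriv_minus_of_nat[OF assms(3)]
    by (simp add: power_add field_simps)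
  finally show ?thesis .
qed

lemma laguerre_pairing_less:
  assumes "n < A" "n < m"
  shows "laguerre_pairing (- int A) m n = (-1) ^ (A + n) / (fact n * fact (A - n - 1) * (of_nat m - of_nat n))"
proof -
  have "laguerre_pairing (- int A) m n =
     (\<Sum>j\<le>n. (-1) ^ (A + n) / (fact m * fact (A - n - 1)) * (fact (m - 1 - j) / fact (n - j)))"
    unfolding laguerre_pairing_eq of_int_minus of_int_of_nat_eq
    using assms by (intro sum.cong refl laguerre_pairing_term) auto
  also have "\<dots> = (-1) ^ (A + n) / (fact m * fact (A - n - 1)) * (fact m / (fact n * (of_nat m - of_nat n)))"
    by (simp only: sum_distrib_left[symmetric] sum_fact_div_fact[OF assms(2)])
  finally show ?thesis by simp
qed

text \<open>The terms with j < n add up to \<open>?c * harm n\<close>. The term j = n carries the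
  digamma value and a harmonic number from the derivative of (y)_n, and the two harmonic numbers
  cancel.\<close>

lemma laguerre_pairing_same:
  assumes "n < A"
  shows "laguerre_pairing (- int A) n n = (-1) ^ (A + n + 1) / (fact n * fact (A - n - 1)) * Digamma (of_nat (A - n))"
proof -
  let ?c = "(-1) ^ (A + n) / (fact n * fact (A - n - 1)) :: complex"
  let ?t = "\<lambda>j. laguerre_coeff (- of_nat A) n j *
     ((pochhammer (- of_nat j) n * gamma_fp (- int A + int j)
        - pochhammer_deriv n (- of_nat j) * gamma_res (- int A + int j)) / fact n)"
  have s: "- int A + int n = - 1 - int (A - 1 - n)" "Suc (A - 1 - n) = A - n" using assms by auto
  have "(\<Sum>j<n. ?t j) = (\<Sum>j<n. ?c * (fact (n - 1 - j) / fact (n - j)))"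
    using assms by (intro sum.cong refl laguerre_pairing_term) auto
  \<comment> \<open>The quotient of factorials is 1/(n - j), written so that the reversal of the
    summation order applies next.\<close>
  also have "\<dots> = (\<Sum>j<n. ?c * inverse (of_nat (Suc (n - Suc j))))"
  proof (intro sum.cong refl)
    fix j assume "j \<in> {..<n}"
    then have "n - j = Suc (n - Suc j)" "n - 1 - j = n - Suc j" by auto
    then show "?c * (fact (n - 1 - j) / fact (n - j)) = ?c * inverse (of_nat (Suc (n - Suc j)))"
      by (simp only: fact_Suc) (simp add: field_simps)
  qed
  also have "\<dots> = ?c * harm n"
    by (simp only: sum.nat_diff_reindex[of "\<lambda>k. ?c * inverse (of_nat (Suc k))"])
       (simp add: harm_def sum.atLeast1_atMost_eq sum_distrib_left)
  finally have low: "(\<Sum>j<n. ?t j) = ?c * harm n" .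
  \<comment> \<open>Here s = -(A - n) is negative, so the finite part is the residue times a digamma
    value and the residue can be factored out.\<close>
  have fp: "gamma_fp (- int A + int n) = gamma_res (- int A + int n) * Digamma (of_nat (A - n))"
    using assms by (simp add: gamma_fp_def of_nat_diff)
  have "?t n = (laguerre_coeff (- of_nat A) n n * gamma_res (- int A + int n)) *
      ((-1) ^ n * fact n * (Digamma (of_nat (A - n)) + harm n)) / fact n"
    unfolding fp pochhammer_deriv_minus_same pochhammer_same by (simp add: algebra_simps)
  also have "\<dots> = - ?c * (Digamma (of_nat (A - n)) + harm n)"
  proof -
    have "(-1) ^ (n + A + n + 1) * (-1) ^ n = - ((-1) ^ (A + n) :: complex)"
      by (simp add: power_add)
    then show ?thesis
      by (simp only: laguerre_coeff_gamma_res[OF assms order_refl]) (simp add: mult.assoc[symmetric])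
  qed
  finally have top: "?t n = - ?c * (Digamma (of_nat (A - n)) + harm n)" .
  have "laguerre_pairing (- int A) n n = (\<Sum>j<n. ?t j) + ?t n"
    unfolding laguerre_pairing_eq by (simp add: lessThan_Suc_atMost[symmetric])
  then show ?thesis unfolding low top by (simp add: ring_distribs)
qed

subsection \<open>Hadamard finite parts\<close>

text \<open>The counterterm for the divergence as d tends to 0. A list may repeat an exponent, so
  counterterms are added by concatenation without merging.\<close>

definition power_log :: "(complex \<times> complex) list \<Rightarrow> complex \<Rightarrow> real \<Rightarrow> complex" where
  "power_log xs b d = (\<Sum>(a, k)\<leftarrow>xs. a * of_real d powr k) + b * of_real (ln d)"

lemma power_log_add: "power_log xs b d + power_log ys c d = power_log (xs @ ys) (b + c) d"
  by (simp add: power_log_def algebra_simps)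

lemma power_log_cmult: "c * power_log xs b d = power_log (map (\<lambda>(a, k). (c * a, k)) xs) (c * b) d"
  by (simp add: power_log_def distrib_left sum_list_const_mult[symmetric] o_def case_prod_unfold mult.assoc)

text \<open>For u = exp(1/|k|) one has u^k = exp(k/|k|). Its exponent has modulus 1, while exp
  equals 1 only at multiples of 2 pi i, whose modulus is 0 or at least 2 pi.\<close>

lemma exists_real_powr_neq_1:
  fixes k :: complex
  assumes "k \<noteq> 0"
  obtains u :: real where "u > 0" "of_real u powr k \<noteq> 1"
proof
  let ?u = "exp (1 / norm k) :: real"
  have l: "of_real ?u powr k = exp (k / of_real (norm k))"
    by (simp add: powr_def Ln_of_real)
  have n: "norm (k / of_real (norm k)) = 1" using assms by (simp add: norm_divide)
  show "of_real ?u powr k \<noteq> 1"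
  proof
    assume "of_real ?u powr k = 1"
    then obtain j :: int where "Re (k / of_real (norm k)) = 0" "Im (k / of_real (norm k)) = of_int (2 * j) * pi"
      unfolding l exp_eq_1 by blast
    then have "(of_int (2 * j) * pi)\<^sup>2 = 1"
      using n by (metis cmod_power2 one_power2 zero_power2 add_0)
    then have "\<bar>of_int (2 * j) * pi\<bar> = 1" using abs_square_eq_1 by blast
    then have j: "real_of_int \<bar>2 * j\<bar> * pi = 1" by (simp add: abs_mult)
    then have "j \<noteq> 0" by auto
    then have "real_of_int \<bar>2 * j\<bar> \<ge> 1" by simp
    then have "real_of_int \<bar>2 * j\<bar> * pi \<ge> 1 * pi" by (intro mult_right_mono) auto
    then show False using j pi_gt3 by linarith
  qed
qed simp

text \<open>The dilation \<open>d \<mapsto> u d\<close> acts on \<open>d powr k\<close> as multiplication by \<open>u powr k\<close>, so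
  \<open>h (u d) - u powr k * h d\<close> has one power fewer than \<open>h\<close>.\<close>

lemma tendsto_0_power_log:
  assumes "((\<lambda>d. power_log xs b d + c) \<longlongrightarrow> 0) (at_right 0)" and "\<And>a k. (a, k) \<in> set xs \<Longrightarrow> k \<noteq> 0"
  shows "b = 0 \<and> c = 0"
  using assms
proof (induction "length xs" arbitrary: xs b c)
  case 0
  then have Nil: "xs = []" by simp
  have lim: "((\<lambda>d. b * of_real (ln d) + c) \<longlongrightarrow> 0) (at_right 0)"
    using 0(2) by (simp add: power_log_def Nil)
  \<comment> \<open>Without powers, the dilation by e changes the function by exactly b, so b is a
    limit of differences tending to 0.\<close>
  have shift: "((\<lambda>d. b * of_real (ln (exp 1 * d)) + c) \<longlongrightarrow> 0) (at_right 0)"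
    by (rule filterlim_compose[OF lim]) (rule filterlim_times_pos, auto simp: filterlim_ident)
  have "((\<lambda>d. b * of_real (ln (exp 1 * d)) + c - (b * of_real (ln d) + c)) \<longlongrightarrow> 0 - 0) (at_right 0)"
    by (intro tendsto_diff lim shift)
  moreover have "eventually (\<lambda>d. b * of_real (ln (exp 1 * d)) + c - (b * of_real (ln d) + c) = b) (at_right 0)"
    using eventually_at_right_less[of "0::real"]
    by eventually_elim (simp add: ln_mult algebra_simps)
  ultimately have "((\<lambda>d::real. b) \<longlongrightarrow> 0 - 0) (at_right 0)"
    by (rule Lim_transform_eventually)
  then have b: "b = 0" by (simp add: tendsto_const_iff)
  then show ?case using lim by (simp add: tendsto_const_iff)
next
  case (Suc n zs)
  obtain a k xs where zs: "zs = (a, k) # xs" "length xs = n"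
    using Suc.hyps(2) by (cases zs) auto
  have "k \<noteq> 0" using Suc.prems(2)[of a k] by (simp add: zs)
  then obtain u :: real where u: "u > 0" "of_real u powr k \<noteq> 1" using exists_real_powr_neq_1 by blast
  let ?w = "of_real u powr k"
  let ?h = "\<lambda>d. power_log zs b d + c"
  define ys where "ys = map (\<lambda>(a', k'). (a' * (of_real u powr k' - ?w), k')) xs"
  have shift: "((\<lambda>d. ?h (u * d)) \<longlongrightarrow> 0) (at_right 0)"
    by (rule filterlim_compose[OF Suc.prems(1)]) (rule filterlim_times_pos, use u in \<open>auto simp: filterlim_ident\<close>)
  have "((\<lambda>d. ?h (u * d) - ?w * ?h d) \<longlongrightarrow> 0 - ?w * 0) (at_right 0)"
    by (intro tendsto_diff tendsto_mult_left shift Suc.prems(1))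
  \<comment> \<open>The head of the list cancels. The logarithm is scaled by 1 - \<open>?w\<close>
    and sheds the constant b ln u, so the induction hypothesis applies with these new
    constants.\<close>
  moreover have "eventually (\<lambda>d. ?h (u * d) - ?w * ?h d =
      power_log ys (b * (1 - ?w)) d + (b * of_real (ln u) + c * (1 - ?w))) (at_right 0)"
    using eventually_at_right_less[of "0::real"]
  proof eventually_elim
    case (elim d)
    have powr: "of_real (u * d) powr k' = of_real u powr k' * of_real d powr k'" for k' :: complex
      using u elim by (simp add: powr_times_real)
    have sum: "(\<Sum>(a, k)\<leftarrow>xs. a * of_real (u * d) powr k) - ?w * (\<Sum>(a, k)\<leftarrow>xs. a * of_real d powr k) =
       (\<Sum>(a, k)\<leftarrow>ys. a * of_real d powr k)"
      unfolding ys_def powr by (induction xs) (auto simp: algebra_simps)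
    have "?h (u * d) - ?w * ?h d = ((\<Sum>(a, k)\<leftarrow>xs. a * of_real (u * d) powr k) - ?w * (\<Sum>(a, k)\<leftarrow>xs. a * of_real d powr k))
       + b * of_real (ln (u * d)) - ?w * b * of_real (ln d) + c * (1 - ?w)"
      unfolding power_log_def zs list.map sum_list.Cons case_prod_conv powr[of k] by (simp add: algebra_simps)
    also have "ln (u * d) = ln u + ln d" using u elim by (simp add: ln_mult)
    finally show ?case unfolding sum power_log_def by (simp add: algebra_simps)
  qed
  ultimately have "((\<lambda>d. power_log ys (b * (1 - ?w)) d + (b * of_real (ln u) + c * (1 - ?w))) \<longlongrightarrow> 0) (at_right 0)"
    using Lim_transform_eventually by fastforce
  then have "b * (1 - ?w) = 0 \<and> b * of_real (ln u) + c * (1 - ?w) = 0"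
    by (rule Suc.hyps(1)[rotated]) (use Suc.prems(2) in \<open>auto simp: ys_def zs\<close>)
  \<comment> \<open>Since \<open>?w\<close> differs from 1, first b = 0 and then c = 0.\<close>
  then show ?case using u by auto
qed

text \<open>Exponent 0 is excluded because a constant in the counterterm could be shifted into
  \<open>V\<close>. The counterterm itself is left existential, so that the relation is stable under
  linear combinations.\<close>

definition has_finite_part :: "(real \<Rightarrow> complex) \<Rightarrow> complex \<Rightarrow> bool" where
  "has_finite_part f V \<longleftrightarrow> (\<forall>d>0. f absolutely_integrable_on {d..}) \<and>
     (\<exists>xs b. (\<forall>(a, k)\<in>set xs. k \<noteq> 0) \<and>
        ((\<lambda>d. integral {d..} f + power_log xs b d) \<longlongrightarrow> V) (at_right 0))"

lemma has_finite_partI: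
  assumes "\<And>d. d > 0 \<Longrightarrow> f absolutely_integrable_on {d..}" "\<And>a k. (a, k) \<in> set xs \<Longrightarrow> k \<noteq> 0"
    "((\<lambda>d. integral {d..} f + power_log xs b d) \<longlongrightarrow> V) (at_right 0)"
  shows "has_finite_part f V"
  using assms unfolding has_finite_part_def by (auto intro!: exI[of _ xs] exI[of _ b])

text \<open>In the difference of the two limits the integrals cancel and only counterterms remain;
  their combination tends to V - W, which must vanish as a constant term.\<close>

lemma has_finite_part_unique:
  assumes "has_finite_part f V" "has_finite_part f W"
  shows "V = W"
proof -
  obtain xs b where xs: "\<forall>(a, k)\<in>set xs. k \<noteq> 0"
    and 1: "((\<lambda>d. integral {d..} f + power_log xs b d) \<longlongrightarrow> V) (at_right 0)"
    using assms(1) unfolding has_finite_part_def by blast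
  obtain ys c where ys: "\<forall>(a, k)\<in>set ys. k \<noteq> 0"
    and 2: "((\<lambda>d. integral {d..} f + power_log ys c d) \<longlongrightarrow> W) (at_right 0)"
    using assms(2) unfolding has_finite_part_def by blast
  let ?zs = "xs @ map (\<lambda>(a, k). (- 1 * a, k)) ys"
  have eq: "power_log ?zs (b + - 1 * c) d = power_log xs b d - power_log ys c d" for d
    by (simp only: power_log_add[symmetric] power_log_cmult[symmetric]) simp
  have "((\<lambda>d. (integral {d..} f + power_log xs b d) - (integral {d..} f + power_log ys c d) - (V - W)) \<longlongrightarrow> (V - W) - (V - W)) (at_right 0)"
    by (intro tendsto_diff 1 2 tendsto_const)
  then have "((\<lambda>d. power_log ?zs (b + - 1 * c) d + - (V - W)) \<longlongrightarrow> 0) (at_right 0)"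
    unfolding eq by (simp add: algebra_simps)
  then show ?thesis
    using tendsto_0_power_log xs ys by fastforce
qed

lemma has_finite_part_add:
  assumes "has_finite_part f V" "has_finite_part g W"
  shows "has_finite_part (\<lambda>r. f r + g r) (V + W)"
proof -
  obtain xs b where xs: "\<forall>(a, k)\<in>set xs. k \<noteq> 0"
    and 1: "((\<lambda>d. integral {d..} f + power_log xs b d) \<longlongrightarrow> V) (at_right 0)"
    using assms(1) unfolding has_finite_part_def by blast
  obtain ys c where ys: "\<forall>(a, k)\<in>set ys. k \<noteq> 0"
    and 2: "((\<lambda>d. integral {d..} g + power_log ys c d) \<longlongrightarrow> W) (at_right 0)"
    using assms(2) unfolding has_finite_part_def by blast
  have int: "f absolutely_integrable_on {d..}" "g absolutely_integrable_on {d..}" if "d > 0" for d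
    using assms that unfolding has_finite_part_def by auto
  show ?thesis
  proof (rule has_finite_partI)
    show "(\<lambda>r. f r + g r) absolutely_integrable_on {d..}" if "d > 0" for d
      using int[OF that] by (rule set_integral_add)
    have "((\<lambda>d. (integral {d..} f + power_log xs b d) + (integral {d..} g + power_log ys c d)) \<longlongrightarrow> V + W) (at_right 0)"
      by (intro tendsto_add 1 2)
    moreover have "eventually (\<lambda>d. (integral {d..} f + power_log xs b d) + (integral {d..} g + power_log ys c d) =
        integral {d..} (\<lambda>r. f r + g r) + power_log (xs @ ys) (b + c) d) (at_right 0)"
      using eventually_at_right_less[of "0::real"]
    proof eventually_elim
      case (elim d)
      then show ?case
        using int[OF elim] by (simp add: Henstock_Kurzweil_Integration.integral_add
            set_lebesgue_integral_eq_integral(1) power_log_add[symmetric])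
    qed
    ultimately show "((\<lambda>d. integral {d..} (\<lambda>r. f r + g r) + power_log (xs @ ys) (b + c) d) \<longlongrightarrow> V + W) (at_right 0)"
      by (rule Lim_transform_eventually)
  qed (use xs ys in auto)
qed

lemma has_finite_part_cmult:
  assumes "has_finite_part f V"
  shows "has_finite_part (\<lambda>r. c * f r) (c * V)"
proof -
  obtain xs b where xs: "\<forall>(a, k)\<in>set xs. k \<noteq> 0"
    and 1: "((\<lambda>d. integral {d..} f + power_log xs b d) \<longlongrightarrow> V) (at_right 0)"
    using assms(1) unfolding has_finite_part_def by blast
  show ?thesis
  proof (rule has_finite_partI)
    show "(\<lambda>r. c * f r) absolutely_integrable_on {d..}" if "d > 0" for d
      using assms that unfolding has_finite_part_def by auto
    have "((\<lambda>d. c * (integral {d..} f + power_log xs b d)) \<longlongrightarrow> c * V) (at_right 0)"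
      by (intro tendsto_mult_left 1)
    then show "((\<lambda>d. integral {d..} (\<lambda>r. c * f r) + power_log (map (\<lambda>(a, k). (c * a, k)) xs) (c * b) d) \<longlongrightarrow> c * V) (at_right 0)"
      by (simp add: distrib_left power_log_cmult)
  qed (use xs in auto)
qed

lemma has_finite_part_0: "has_finite_part (\<lambda>_. 0) 0"
  by (rule has_finite_partI[of _ "[]" 0]) (auto simp: power_log_def)

lemma has_finite_part_sum:
  "(\<And>i. i \<in> I \<Longrightarrow> has_finite_part (f i) (V i)) \<Longrightarrow> has_finite_part (\<lambda>r. \<Sum>i\<in>I. f i r) (\<Sum>i\<in>I. V i)"
  by (induction I rule: infinite_finite_induct) (auto intro: has_finite_part_0 has_finite_part_add)

lemma has_finite_part_cong:
  assumes "\<And>r. r > 0 \<Longrightarrow> f r = g r"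
  shows "has_finite_part f V \<longleftrightarrow> has_finite_part g V"
proof -
  have *: "has_finite_part g V" if fp: "has_finite_part f V" and eq: "\<And>r. r > 0 \<Longrightarrow> f r = g r" for f g
  proof -
    obtain xs b where xs: "\<forall>(a, k)\<in>set xs. k \<noteq> 0"
      and 1: "((\<lambda>d. integral {d..} f + power_log xs b d) \<longlongrightarrow> V) (at_right 0)"
      using fp unfolding has_finite_part_def by blast
    show ?thesis
    proof (rule has_finite_partI)
      fix d :: real assume "d > 0"
      then show "g absolutely_integrable_on {d..}"
        using fp eq set_integrable_cong[OF refl refl, of "{d..}" f g] unfolding has_finite_part_def by auto
    next
      have "eventually (\<lambda>d. integral {d..} f + power_log xs b d = integral {d..} g + power_log xs b d) (at_right 0)"
        using eventually_at_right_less[of "0::real"]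
        by eventually_elim (use eq in \<open>auto intro!: integral_cong\<close>)
      with 1 show "((\<lambda>d. integral {d..} g + power_log xs b d) \<longlongrightarrow> V) (at_right 0)"
        by (rule Lim_transform_eventually)
    qed (use xs in auto)
  qed
  show ?thesis by (rule iffI) (erule *, simp add: assms)+
qed

section \<open>Generalized integrals as finite parts\<close>

lemma has_integral_complex_powr:
  fixes k :: complex
  assumes "0 < d" "d \<le> 1"
  shows "((\<lambda>r. of_real r powr k) has_integral
     (if k = - 1 then - of_real (ln d) else (1 - of_real d powr (k + 1)) / (k + 1))) {d..1}"
proof (cases "k = - 1")
  case True
  have "((\<lambda>r. of_real r powr k) has_integral (of_real (ln 1) - of_real (ln d))) {d..1}"
  proof (rule fundamental_theorem_of_calculus)
    fix r assume r: "r \<in> {d..1}"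
    have "((\<lambda>r. complex_of_real (ln r)) has_vector_derivative of_real (inverse r)) (at r within {d..1})"
      by (rule has_vector_derivative_of_real)
         (use r assms in \<open>auto intro!: derivative_eq_intros simp: inverse_eq_divide has_real_derivative_iff_has_vector_derivative[symmetric]\<close>)
    then show "((\<lambda>r. of_real (ln r)) has_vector_derivative of_real r powr k) (at r within {d..1})"
      using r assms True powr_minus[of "complex_of_real r" 1] by simp
  qed (use assms in auto)
  then show ?thesis using True by simp
next
  case False
  then have k: "k + 1 \<noteq> 0" by (simp add: add_eq_0_iff2)
  have "((\<lambda>r. of_real r powr k) has_integral (of_real 1 powr (k + 1) / (k + 1) - of_real d powr (k + 1) / (k + 1))) {d..1}"
  proof (rule fundamental_theorem_of_calculus)
    fix r assume r: "r \<in> {d..1}"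
    have "((\<lambda>z. z powr (k + 1) / (k + 1)) has_field_derivative of_real r powr k) (at (of_real r))"
      using r assms k by (auto intro!: derivative_eq_intros)
    then show "((\<lambda>r. of_real r powr (k + 1) / (k + 1)) has_vector_derivative of_real r powr k) (at r within {d..1})"
      by (rule has_vector_derivative_real_field)
  qed (use assms in auto)
  then show ?thesis using False by (simp add: diff_divide_distrib)
qed

text \<open>Passage between the open intervals of the generalized integral and the closed ones of
  the finite part; they differ by the null set {0, 1}.\<close>

lemma integral_unit_and_tail_endpoints:
  fixes f :: "real \<Rightarrow> complex"
  shows "f absolutely_integrable_on {0..1} \<longleftrightarrow> f absolutely_integrable_on {0<..<1}"
    and "f absolutely_integrable_on {1..} \<longleftrightarrow> f absolutely_integrable_on {1<..}"
    and "integral {0<..<1} f = integral {0..1} f" "integral {1<..} f = integral {1..} f"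
proof -
  have neg: "negligible {x \<in> {0..1} - {0<..<1}. f x \<noteq> 0}" "negligible {x \<in> {0<..<1} - {0..1}. f x \<noteq> 0}"
    "negligible {x \<in> {1..} - {1<..}. f x \<noteq> 0}" "negligible {x \<in> {1<..} - {1..}. f x \<noteq> 0}"
    by (rule negligible_subset[of "{0, 1 :: real}"]; force)+
  show "f absolutely_integrable_on {0..1} \<longleftrightarrow> f absolutely_integrable_on {0<..<1}"
    and "f absolutely_integrable_on {1..} \<longleftrightarrow> f absolutely_integrable_on {1<..}"
    by (rule absolutely_integrable_spike_set_eq; rule neg)+
  show "integral {0<..<1} f = integral {0..1} f" "integral {1<..} f = integral {1..} f"
    by (rule integral_spike_set; rule neg)+
qed

text \<open>Over [d, 1] the power r^k integrates to (1 - d^(k+1))/(k + 1). The constants make up the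
  sum in \<open>gen_value\<close>, the powers of d are cancelled by the counterterm, and k = -1
  yields a pure logarithm.\<close>

lemma gen_expansion_has_finite_part:
  assumes "gen_expansion f \<Omega> c"
  shows "has_finite_part f (gen_value f \<Omega> c)"
proof -
  let ?S = "\<lambda>r. \<Sum>k\<in>\<Omega>. c k * of_real r powr k"
  let ?g = "\<lambda>r. f r - ?S r"
  have fin: "finite \<Omega>" and f1: "f absolutely_integrable_on {1..}" and g: "?g absolutely_integrable_on {0..1}"
    using assms unfolding gen_expansion_def by (auto simp: integral_unit_and_tail_endpoints)
  have val: "gen_value f \<Omega> c = (\<Sum>k\<in>\<Omega> - {- 1}. c k / (k + 1)) + integral {0..1} ?g + integral {1..} f"
    using assms unfolding gen_value_def gen_expansion_def
    by (simp add: set_lebesgue_integral_eq_integral integral_unit_and_tail_endpoints)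
  have S: "(?S has_integral (\<Sum>k\<in>\<Omega>. c k * (if k = - 1 then - of_real (ln d) else (1 - of_real d powr (k + 1)) / (k + 1)))) {d..1}"
    if "0 < d" "d \<le> 1" for d
    using that by (intro has_integral_sum has_integral_mult_right fin has_integral_complex_powr)
  have fd: "f absolutely_integrable_on {d..1}" if "0 < d" "d \<le> 1" for d
  proof -
    have "?S absolutely_integrable_on {d..1}"
      using that by (intro absolutely_integrable_continuous_real) (auto intro!: continuous_intros)
    moreover have "?g absolutely_integrable_on {d..1}"
      using absolutely_integrable_on_subinterval[OF g] that by simp
    ultimately show ?thesis
      using set_integral_add(1)[of lebesgue "{d..1}" ?g ?S] by simp
  qed
  obtain ks where ks: "set ks = \<Omega> - {- 1}" "distinct ks"
    using finite_distinct_list[of "\<Omega> - {- 1}"] fin by auto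
  define xs where "xs = map (\<lambda>k. (c k / (k + 1), k + 1)) ks"
  \<comment> \<open>The value of c at -1 is arbitrary if -1 lies outside \<Omega>, hence the default
    0.\<close>
  define b where "b = (if - 1 \<in> \<Omega> then c (- 1) else 0)"
  have xs: "power_log xs b d = (\<Sum>k\<in>\<Omega> - {- 1}. c k / (k + 1) * of_real d powr (k + 1)) + b * of_real (ln d)" for d
    using sum_list_distinct_conv_sum_set[OF ks(2)] by (simp add: power_log_def xs_def o_def ks(1))
  have int: "integral {d..} f + power_log xs b d =
      (\<Sum>k\<in>\<Omega> - {- 1}. c k / (k + 1)) + integral {d..1} ?g + integral {1..} f" if d: "0 < d" "d \<le> 1" for d
  proof -
    have "{d..} = {d..1} \<union> {1..}" using d by auto
    then have "integral {d..} f = integral {d..1} f + integral {1..} f"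
      using fd[OF d] f1 d by (simp add: set_lebesgue_integral_eq_integral negligible_subset[of "{1}"] subset_iff)
    moreover have "integral {d..1} ?g = integral {d..1} f - integral {d..1} ?S"
      by (rule integral_diff[OF set_lebesgue_integral_eq_integral(1)[OF fd[OF d]] has_integral_integrable[OF S[OF d]]])
    moreover have "integral {d..1} ?S = (\<Sum>k\<in>\<Omega>. c k * (if k = - 1 then - of_real (ln d) else (1 - of_real d powr (k + 1)) / (k + 1)))"
      using S[OF d] by (rule integral_unique)
    moreover have "\<dots> = (\<Sum>k\<in>\<Omega> - {- 1}. c k / (k + 1)) - power_log xs b d"
    proof -
      let ?t = "\<lambda>k. c k * (if k = - 1 then - of_real (ln d) else (1 - of_real d powr (k + 1)) / (k + 1))"
      have "(\<Sum>k\<in>\<Omega>. ?t k) = - b * of_real (ln d) + (\<Sum>k\<in>\<Omega> - {- 1}. ?t k)"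
      proof (cases "- 1 \<in> \<Omega>")
        case True
        have "?t (- 1) = - b * of_real (ln d)" using True by (simp add: b_def)
        then show ?thesis using sum.remove[OF fin True, of ?t] by (simp only:)
      next
        case False
        then have "\<Omega> - {- 1} = \<Omega>" "b = 0" by (auto simp: b_def)
        then show ?thesis by (simp only:) simp
      qed
      also have "(\<Sum>k\<in>\<Omega> - {- 1}. ?t k) =
         (\<Sum>k\<in>\<Omega> - {- 1}. c k / (k + 1) - c k / (k + 1) * of_real d powr (k + 1))"
        by (intro sum.cong refl) (auto simp: diff_divide_distrib algebra_simps)
      finally show ?thesis by (simp add: sum_subtractf xs)
    qed
    ultimately show ?thesis by simp
  qed
  show ?thesis
  proof (rule has_finite_partI[of _ xs b])
    fix d :: real assume d: "d > 0"
    \<comment> \<open>The minimum also covers d > 1, where [d, 1] would be empty.\<close>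
    have "f absolutely_integrable_on ({min d 1..1} \<union> {1..})"
      by (rule absolutely_integrable_Un[OF fd f1]) (use d in auto)
    then show "f absolutely_integrable_on {d..}"
      by (rule set_integrable_subset) auto
  next
    have "continuous_on {0..1} (\<lambda>d. integral {d..1} ?g)"
      by (rule indefinite_integral_continuous_1'[OF set_lebesgue_integral_eq_integral(1)[OF g]])
    then have "((\<lambda>d. integral {d..1} ?g) \<longlongrightarrow> integral {0..1} ?g) (at 0 within {0..1})"
      by (simp add: continuous_on_def)
    then have "((\<lambda>d. integral {d..1} ?g) \<longlongrightarrow> integral {0..1} ?g) (at_right 0)"
      by (simp add: at_within_Icc_at_right)
    then have "((\<lambda>d. (\<Sum>k\<in>\<Omega> - {- 1}. c k / (k + 1)) + integral {d..1} ?g + integral {1..} f) \<longlongrightarrow> gen_value f \<Omega> c) (at_right 0)"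
      unfolding val by (intro tendsto_add tendsto_const)
    moreover have "eventually (\<lambda>d. (\<Sum>k\<in>\<Omega> - {- 1}. c k / (k + 1)) + integral {d..1} ?g + integral {1..} f =
        integral {d..} f + power_log xs b d) (at_right 0)"
      using eventually_at_right_real[OF zero_less_one] by eventually_elim (simp add: int)
    ultimately show "((\<lambda>d. integral {d..} f + power_log xs b d) \<longlongrightarrow> gen_value f \<Omega> c) (at_right 0)"
      by (rule Lim_transform_eventually)
  next
    fix a k assume "(a, k) \<in> set xs"
    then obtain k' where "k' \<in> set ks" "k = k' + 1" unfolding xs_def by auto
    then show "k \<noteq> 0" unfolding ks(1) by (simp add: add_eq_0_iff2)
  qed
qed

text \<open>Every expansion yields a finite part, and finite parts are unique; hence all expansions
  give the value V and the description is proper.\<close>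

lemma gen_integral_eqI:
  assumes "gen_integrable f" "has_finite_part f V"
  shows "gen_integral f = V"
  unfolding gen_integral_def
proof (rule the_equality)
  have uniq: "I = V" if "gen_expansion f \<Omega> c" "I = gen_value f \<Omega> c" for I \<Omega> c
    unfolding that(2) by (rule has_finite_part_unique[OF gen_expansion_has_finite_part[OF that(1)] assms(2)])
  then show "I = V" if "\<exists>\<Omega> c. gen_expansion f \<Omega> c \<and> I = gen_value f \<Omega> c" for I
    using that by blast
  obtain \<Omega> c where e: "gen_expansion f \<Omega> c" using assms(1) unfolding gen_integrable_def by blast
  show "\<exists>\<Omega> c. gen_expansion f \<Omega> c \<and> V = gen_value f \<Omega> c"
    using e uniq[OF e refl] by metis
qed

subsection \<open>Finite parts of powers times an exponential\<close>

text \<open>This is (e^x - sum of x^k/k! over k < q) / x^q with the removable singularity at 0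
  filled in.\<close>

definition exp_tail :: "nat \<Rightarrow> real \<Rightarrow> real" where
  "exp_tail q x = (\<Sum>n. x ^ n / fact (n + q))"

lemma summable_exp_tail: "summable (\<lambda>n. x ^ n / fact (n + q) :: real)"
proof (rule summable_comparison_test')
  show "summable (\<lambda>n. \<bar>x\<bar> ^ n /\<^sub>R fact n)" by (rule summable_exp_generic)
  fix n :: nat
  have "\<bar>x\<bar> ^ n / fact (n + q) \<le> \<bar>x\<bar> ^ n / fact n"
    by (intro divide_left_mono fact_mono) auto
  then show "norm (x ^ n / fact (n + q)) \<le> \<bar>x\<bar> ^ n /\<^sub>R fact n"
    by (simp add: power_abs field_simps)
qed

lemma exp_eq_exp_tail: "exp x = (\<Sum>k<q. x ^ k / fact k) + x ^ q * exp_tail q x"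
proof -
  have "exp x = (\<Sum>n. x ^ n / fact n)" by (simp add: exp_def field_simps)
  also have "\<dots> = (\<Sum>n. x ^ (n + q) / fact (n + q)) + (\<Sum>k<q. x ^ k / fact k)"
    using summable_exp_tail[of x 0] by (intro suminf_split_initial_segment) simp
  also have "(\<Sum>n. x ^ (n + q) / fact (n + q)) = x ^ q * exp_tail q x"
    unfolding exp_tail_def by (subst suminf_mult[OF summable_exp_tail, symmetric]) (simp add: power_add mult.commute)
  finally show ?thesis by simp
qed

lemma exp_tail_0: "exp_tail q 0 = 1 / fact q"
  using suminf_finite[of "{0}" "\<lambda>n. 0 ^ n / fact (n + q) :: real"] by (simp add: exp_tail_def)

lemma continuous_on_exp_tail [continuous_intros]:
  assumes "continuous_on S f"
  shows "continuous_on S (\<lambda>x. exp_tail q (f x))"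
proof -
  have "isCont (\<lambda>x. \<Sum>n. (1 / fact (n + q)) * x ^ n) x" for x :: real
    using summable_exp_tail[of _ q] by (intro isCont_powser_converges_everywhere) simp
  then have "continuous_on UNIV (exp_tail q)"
    by (auto simp: exp_tail_def[abs_def] intro!: continuous_at_imp_continuous_on)
  from continuous_on_compose2[OF this assms] show ?thesis by simp
qed

text \<open>Splits off the negative powers of r from r^(-q) e^(-r); the remainder extends
  continuously to r = 0.\<close>

lemma powi_mult_exp_minus:
  assumes "r > 0"
  shows "r powi (- int q) * exp (- r) = (\<Sum>k<q. (- 1) ^ k / fact k * r powi (int k - int q)) + (- 1) ^ q * exp_tail q (- r)"
proof -
  have pow: "r powi (- int q) * (- r) ^ k = (- 1) ^ k * r powi (int k - int q)" for k
  proof -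
    have "(- r) ^ k = (- 1) ^ k * r ^ k" using power_mult_distrib[of "- 1" r k] by simp
    then show ?thesis
      using assms by (simp add: power_int_diff power_int_minus field_simps)
  qed
  have "r powi (- int q) * exp (- r) = (\<Sum>k<q. r powi (- int q) * (- r) ^ k / fact k) + r powi (- int q) * (- r) ^ q * exp_tail q (- r)"
    by (subst exp_eq_exp_tail[of "- r" q]) (simp add: distrib_left sum_distrib_left mult.assoc)
  then show ?thesis unfolding pow by simp
qed

definition exp_powi :: "int \<Rightarrow> real \<Rightarrow> complex" where
  "exp_powi s r = of_real (r powi s * exp (- r))"

text \<open>For s \<ge> 0 this is a restriction of the Gamma integral; for s < 0 the power is
  bounded by its value at d, leaving an exponential as majorant.\<close>

lemma exp_powi_absolutely_integrable:
  assumes "d > 0"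
  shows "exp_powi s absolutely_integrable_on {d..}"
proof (cases "s \<ge> 0")
  case True
  have "(\<lambda>t. complex_of_real t powr (of_int (s + 1) - 1) / of_real (exp t)) absolutely_integrable_on {0<..}"
    using True by (intro absolutely_integrable_Gamma_integral') auto
  then have "(\<lambda>t. complex_of_real t powr (of_int (s + 1) - 1) / of_real (exp t)) absolutely_integrable_on {d..}"
    by (rule set_integrable_subset) (use assms in auto)
  also have "?this \<longleftrightarrow> ?thesis"
    by (rule set_integrable_cong)
       (use assms in \<open>auto simp: exp_powi_def exp_minus field_simps complex_powr_of_int of_real_power_int\<close>)
  finally show ?thesis .
next
  case False
  show ?thesis
  proof (rule measurable_bounded_by_integrable_imp_absolutely_integrable)
    show "exp_powi s \<in> borel_measurable (lebesgue_on {d..})"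
      unfolding exp_powi_def[abs_def] using assms
      by (intro continuous_imp_measurable_on_sets_lebesgue) (auto intro!: continuous_intros)
    show "(\<lambda>r. d powi s * exp (- 1 * r)) integrable_on {d..}"
      by (intro integrable_on_mult_right integrable_on_exp_minus_to_infinity) auto
    fix r assume r: "r \<in> {d..}"
    have "r powi s = inverse (r ^ nat (- s))" "d powi s = inverse (d ^ nat (- s))"
      using False by (auto simp: power_int_def power_inverse)
    moreover have "inverse (r ^ nat (- s)) \<le> inverse (d ^ nat (- s))"
      using r assms by (intro le_imp_inverse_le power_mono) auto
    ultimately have "r powi s * exp (- r) \<le> d powi s * exp (- r)"
      by (intro mult_right_mono) auto
    moreover have "norm (exp_powi s r) = r powi s * exp (- r)"
      using r assms unfolding exp_powi_def norm_of_real by (intro abs_of_nonneg) auto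
    ultimately show "norm (exp_powi s r) \<le> d powi s * exp (- 1 * r)" by simp
  qed auto
qed

lemma exp_powi_tendsto_0: "(exp_powi s \<longlongrightarrow> 0) at_top"
proof -
  have "((\<lambda>r::real. r powi s * exp (- r)) \<longlongrightarrow> 0) at_top"
  proof (rule tendsto_sandwich[OF _ _ tendsto_const tendsto_power_div_exp_0])
    show "eventually (\<lambda>r::real. 0 \<le> r powi s * exp (- r)) at_top"
      using eventually_ge_at_top[of 1] by eventually_elim simp
    show "eventually (\<lambda>r::real. r powi s * exp (- r) \<le> r ^ nat \<bar>s\<bar> / exp r) at_top"
      using eventually_ge_at_top[of 1]
    proof eventually_elim
      case (elim r)
      have "r powi s \<le> r powi \<bar>s\<bar>" using elim by (intro power_int_increasing) auto
      then have "r powi s \<le> r ^ nat \<bar>s\<bar>" by (simp add: power_int_def)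
      then show ?case by (simp add: exp_minus divide_inverse)
    qed
  qed
  then have "((\<lambda>r. complex_of_real (r powi s * exp (- r))) \<longlongrightarrow> of_real 0) at_top"
    by (rule tendsto_of_real)
  then show ?thesis by (simp add: exp_powi_def[abs_def])
qed

lemma exp_powi_has_vector_derivative:
  assumes "r > 0"
  shows "(exp_powi (s + 1) has_vector_derivative of_int (s + 1) * exp_powi s r - exp_powi (s + 1) r) (at r within A)"
proof -
  have "((\<lambda>r. r powi (s + 1) * exp (- r)) has_real_derivative
      real_of_int (s + 1) * (r powi s * exp (- r)) - r powi (s + 1) * exp (- r)) (at r within A)"
    using assms by (auto intro!: derivative_eq_intros simp: algebra_simps)
  then have "((\<lambda>r. complex_of_real (r powi (s + 1) * exp (- r))) has_vector_derivative
      of_real (real_of_int (s + 1) * (r powi s * exp (- r)) - r powi (s + 1) * exp (- r))) (at r within A)"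
    by (intro has_vector_derivative_of_real) (simp add: has_real_derivative_iff_has_vector_derivative)
  then show ?thesis by (simp add: exp_powi_def[abs_def])
qed

text \<open>The fundamental theorem on [d, d + n], followed by dominated convergence with majorant
  |f|.\<close>

lemma has_integral_derivative_to_infinity:
  fixes F f :: "real \<Rightarrow> complex"
  assumes F: "\<And>x. x \<ge> d \<Longrightarrow> (F has_vector_derivative f x) (at x)"
    and f: "f absolutely_integrable_on {d..}" and lim: "(F \<longlongrightarrow> 0) at_top"
  shows "(f has_integral - F d) {d..}"
proof (rule has_integral_dominated_convergence)
  fix n :: nat
  have "(f has_integral (F (d + real n) - F d)) {d..d + real n}"
    by (rule fundamental_theorem_of_calculus) (auto intro!: has_vector_derivative_at_within F)
  then show "((\<lambda>x. if x \<in> {d..d + real n} then f x else 0) has_integral (F (d + real n) - F d)) {d..}"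
    by (subst has_integral_restrict) auto
next
  show "(\<lambda>x. norm (f x)) integrable_on {d..}"
    using f by (simp add: absolutely_integrable_on_def)
next
  show "\<forall>x\<in>{d..}. (\<lambda>n. if x \<in> {d..d + real n} then f x else 0) \<longlonglongrightarrow> f x"
  proof
    fix x assume "x \<in> {d..}"
    have "eventually (\<lambda>n. real n \<ge> x - d) sequentially"
      using filterlim_real_sequentially unfolding filterlim_at_top by blast
    then have "eventually (\<lambda>n. (if x \<in> {d..d + real n} then f x else 0) = f x) sequentially"
      by eventually_elim (use \<open>x \<in> {d..}\<close> in auto)
    then show "(\<lambda>n. if x \<in> {d..d + real n} then f x else 0) \<longlonglongrightarrow> f x"
      by (rule tendsto_eventually)
  qed
next
  have "filterlim (\<lambda>n. d + real n) at_top sequentially"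
    by (rule filterlim_tendsto_add_at_top[OF tendsto_const filterlim_real_sequentially])
  then have "(\<lambda>n. F (d + real n)) \<longlonglongrightarrow> 0" by (rule filterlim_compose[OF lim])
  then have "(\<lambda>n. F (d + real n) - F d) \<longlonglongrightarrow> 0 - F d" by (intro tendsto_diff tendsto_const)
  then show "(\<lambda>n. F (d + real n) - F d) \<longlonglongrightarrow> - F d" by simp
qed auto

text \<open>The boundary term of integration by parts. The integrand is the derivative of r^(s+1)
  e^(-r), so its tail integral is -d^(s+1) e^(-d), whose constant term in d is minus the coefficient
  of r^(-s-1) in e^(-r), that is \<open>- gamma_res s\<close>.\<close>

lemma has_finite_part_exp_powi_derivative:
  "has_finite_part (\<lambda>r. of_int (s + 1) * exp_powi s r - exp_powi (s + 1) r) (- gamma_res s)"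
proof -
  let ?f = "\<lambda>r. of_int (s + 1) * exp_powi s r - exp_powi (s + 1) r"
  have f: "?f absolutely_integrable_on {d..}" if "d > 0" for d
    using that by (intro set_integral_diff(1) set_integrable_mult_right exp_powi_absolutely_integrable)
  have int: "integral {d..} ?f = - exp_powi (s + 1) d" if "d > 0" for d
    using has_integral_derivative_to_infinity[OF _ f[OF that] exp_powi_tendsto_0[of "s + 1"]]
      exp_powi_has_vector_derivative[of _ s UNIV] that by (intro integral_unique) auto
  show ?thesis
  proof (cases "s \<ge> 0")
    case True
    show ?thesis
    proof (rule has_finite_partI[of _ "[]" 0])
      have "((\<lambda>d::real. - complex_of_real (d ^ nat (s + 1) * exp (- d))) \<longlongrightarrow> - complex_of_real (0 ^ nat (s + 1) * exp (- 0))) (at_right 0)"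
        by (intro tendsto_intros)
      moreover have "eventually (\<lambda>d. - complex_of_real (d ^ nat (s + 1) * exp (- d)) = integral {d..} ?f + power_log [] 0 d) (at_right 0)"
        using eventually_at_right_less[of "0::real"]
        by eventually_elim (subst int, assumption, use True in \<open>simp add: power_log_def exp_powi_def power_int_def\<close>)
      ultimately have "((\<lambda>d. integral {d..} ?f + power_log [] 0 d) \<longlongrightarrow> - complex_of_real (0 ^ nat (s + 1) * exp (- 0))) (at_right 0)"
        by (rule Lim_transform_eventually)
      then show "((\<lambda>d. integral {d..} ?f + power_log [] 0 d) \<longlongrightarrow> - gamma_res s) (at_right 0)"
        using True by (simp add: gamma_res_def power_0_left)
    qed (use f in auto)
  next
    case False
    define q where "q = nat (- s - 1)"
    have s: "s = - 1 - int q" "s + 1 = - int q" using False by (auto simp: q_def)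
    \<comment> \<open>These are the negative powers of d in d^(-q) e^(-d); all exponents k - q are
      nonzero as k < q.\<close>
    define xs :: "(complex \<times> complex) list" where
      "xs = map (\<lambda>k. ((- 1) ^ k / fact k, of_int (int k - int q))) [0..<q]"
    have cont: "continuous_on {0..} (\<lambda>d. - complex_of_real ((- 1) ^ q * exp_tail q (- d)))"
      by (intro continuous_intros)
    have "((\<lambda>d. - complex_of_real ((- 1) ^ q * exp_tail q (- d))) \<longlongrightarrow> - complex_of_real ((- 1) ^ q * exp_tail q (- 0))) (at 0 within {0..})"
      by (rule cont[unfolded continuous_on_def, THEN bspec]) simp
    then have lim: "((\<lambda>d. - complex_of_real ((- 1) ^ q * exp_tail q (- d))) \<longlongrightarrow> - gamma_res s) (at_right 0)"
      unfolding s(1) gamma_res_neg by (rule tendsto_within_subset[THEN tendsto_eq_rhs]) (auto simp: exp_tail_0)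
    show ?thesis
    proof (rule has_finite_partI[of _ xs 0])
      have "eventually (\<lambda>d. - complex_of_real ((- 1) ^ q * exp_tail q (- d)) = integral {d..} ?f + power_log xs 0 d) (at_right 0)"
        using eventually_at_right_less[of "0::real"]
      proof eventually_elim
        case (elim d)
        have "power_log xs 0 d = (\<Sum>k<q. (- 1) ^ k / fact k * of_real d powr of_int (int k - int q))"
          by (simp add: power_log_def xs_def o_def interv_sum_list_conv_sum_set_nat atLeast0LessThan del: of_int_diff)
        also have "\<dots> = complex_of_real (\<Sum>k<q. (- 1) ^ k / fact k * d powi (int k - int q))"
          using elim by (simp add: complex_powr_of_int del: of_int_diff)
        finally show ?case
          unfolding int[OF elim] unfolding s(2) exp_powi_def powi_mult_exp_minus[OF elim] by simp
      qed
      with lim show "((\<lambda>d. integral {d..} ?f + power_log xs 0 d) \<longlongrightarrow> - gamma_res s) (at_right 0)"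
        by (rule Lim_transform_eventually)
    next
      show "k \<noteq> 0" if "(a, k) \<in> set xs" for a k
        using that by (auto simp: xs_def)
    qed (rule f)
  qed
qed

text \<open>Writing 1/e as the integral of t^(e-1) over [0, 1] represents Gamma(e) - 1/e by one
  integral, and e tends to 0 under the integral sign.\<close>

lemma has_integral_Digamma_1:
  "((\<lambda>t. if t \<in> {0..1} then (exp (- t) - 1) / t else exp (- t) / t) has_integral Digamma (1 :: real)) {0..}"
proof (rule has_integral_dominated_convergence)
  define e where "e n = inverse (real (Suc n))" for n
  have e: "e n > 0" "e n \<le> 1" for n unfolding e_def by (auto simp: field_simps)
  have e_lim: "e \<longlonglongrightarrow> 0" unfolding e_def by (rule LIMSEQ_inverse_real_of_nat)
  let ?f = "\<lambda>n t. t powr (e n - 1) / exp t - (if t \<in> {0..1} then t powr (e n - 1) else 0)"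
  show "(?f n has_integral (Gamma (e n) - 1 / e n)) {0..}" for n
  proof (rule has_integral_diff)
    show "((\<lambda>t. t powr (e n - 1) / exp t) has_integral Gamma (e n)) {0..}"
      by (rule Gamma_integral_real) (rule e)
    have "((\<lambda>t. t powr (e n - 1)) has_integral (1 / e n)) {0..1}"
      using has_integral_powr_from_0[of "e n - 1" 1] e[of n] by simp
    then show "((\<lambda>t. if t \<in> {0..1} then t powr (e n - 1) else 0) has_integral (1 / e n)) {0..}"
      by (subst has_integral_restrict) auto
  qed
  \<comment> \<open>On (0, 1] the integrands are at most t^e \<le> 1 in modulus, and 1 \<le> 3
    e^(-t) there because exp 1 \<le> 3; beyond 1 they are at most e^(-t).\<close>
  show "(\<lambda>t. 3 * exp (- 1 * t)) integrable_on {0 :: real..}"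
    by (intro integrable_on_mult_right integrable_on_exp_minus_to_infinity) auto
  show "\<forall>t\<in>{0..}. norm (?f n t) \<le> 3 * exp (- 1 * t)" for n
  proof
    fix t :: real assume t: "t \<in> {0..}"
    consider "t = 0" | "0 < t" "t \<le> 1" | "t > 1" using t by force
    then show "norm (?f n t) \<le> 3 * exp (- 1 * t)"
    proof cases
      case 2
      have "?f n t = - (t powr (e n - 1) * (1 - exp (- t)))"
        using 2 by (simp add: exp_minus field_simps)
      moreover have "1 - exp (- t) \<ge> 0" "1 - exp (- t) \<le> t" using 2 exp_ge_add_one_self[of "- t"] by auto
      ultimately have "norm (?f n t) \<le> t powr (e n - 1) * t"
        by (simp add: abs_mult mult_left_mono)
      also have "\<dots> = t powr e n" using 2 by (simp add: powr_diff)
      also have "\<dots> \<le> 1" using 2 e[of n] by (intro powr_le1) auto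
      also have "1 \<le> 3 * exp (- 1 :: real)" using exp_le by (simp add: exp_minus field_simps)
      also have "\<dots> \<le> 3 * exp (- 1 * t)" using 2 by simp
      finally show ?thesis .
    next
      case 3
      have "t powr (e n - 1) \<le> t powr 0" using 3 e[of n] by (intro powr_mono) auto
      then have "t powr (e n - 1) * exp (- t) \<le> 3 * exp (- t)"
        using 3 by (intro mult_right_mono) auto
      then show ?thesis using 3 by (simp add: exp_minus field_simps)
    qed auto
  qed
  show "\<forall>t\<in>{0..}. (\<lambda>n. ?f n t) \<longlonglongrightarrow> (if t \<in> {0..1} then (exp (- t) - 1) / t else exp (- t) / t)"
  proof
    fix t :: real assume t: "t \<in> {0..}"
    \<comment> \<open>At t = 0 both sides are 0, by the conventions \<open>0 powr a = 0\<close> and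
      \<open>a / 0 = 0\<close>.\<close>
    show "(\<lambda>n. ?f n t) \<longlonglongrightarrow> (if t \<in> {0..1} then (exp (- t) - 1) / t else exp (- t) / t)"
    proof (cases "t = 0")
      case False
      then have powr: "(\<lambda>n. t powr (e n - 1)) \<longlonglongrightarrow> t powr (0 - 1)"
        by (intro tendsto_intros e_lim) auto
      have "(\<lambda>n. ?f n t) \<longlonglongrightarrow> t powr (0 - 1) / exp t - (if t \<in> {0..1} then t powr (0 - 1) else 0)"
        by (cases "t \<in> {0..1}"; simp only: if_True if_False; intro tendsto_diff tendsto_divide tendsto_const powr; simp)
      also have "t powr (0 - 1) / exp t - (if t \<in> {0..1} then t powr (0 - 1) else 0) =
          (if t \<in> {0..1} then (exp (- t) - 1) / t else exp (- t) / t)"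
        using t False by (auto simp: powr_minus exp_minus field_simps)
      finally show ?thesis .
    qed auto
  qed
  \<comment> \<open>As Gamma(1 + e) = e Gamma(e), the value Gamma(e) - 1/e is a difference quotient
    of Gamma at 1, with limit Gamma'(1) = psi(1).\<close>
  have "(Gamma has_field_derivative (Gamma 1 * Digamma 1)) (at (1 :: real))"
    by (rule has_field_derivative_Gamma) auto
  then have "((\<lambda>h. (Gamma (1 + h) - Gamma 1) / h) \<longlongrightarrow> Digamma 1) (at (0 :: real))"
    by (simp add: DERIV_def)
  moreover have "filterlim e (at 0) sequentially"
    using e_lim e by (intro filterlim_atI) (auto simp: less_imp_neq[symmetric] intro!: always_eventually)
  ultimately have "(\<lambda>n. (Gamma (1 + e n) - Gamma 1) / e n) \<longlonglongrightarrow> Digamma 1"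
    by (rule filterlim_compose)
  also have "(\<lambda>n. (Gamma (1 + e n) - Gamma 1) / e n) = (\<lambda>n. Gamma (e n) - 1 / e n)"
  proof
    fix n
    have "Gamma (1 + e n) = e n * Gamma (e n)"
      using Gamma_plus1[of "e n"] e(1)[of n] nonpos_Ints_nonpos[of "e n"] by (force simp: add.commute)
    then show "(Gamma (1 + e n) - Gamma 1) / e n = Gamma (e n) - 1 / e n"
      using e(1)[of n] by (simp add: field_simps)
  qed
  finally show "(\<lambda>n. Gamma (e n) - 1 / e n) \<longlonglongrightarrow> Digamma 1" .
qed

text \<open>The preceding integrand is e^(-r)/r with 1/r removed on [0, 1]. Over [d, 1] the removed
  part integrates to -ln d, so the counterterm is ln d and the limit is the full integral
  psi(1).\<close>

lemma has_finite_part_exp_powi_minus_1: "has_finite_part (exp_powi (- 1)) (Digamma 1)"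
proof -
  define G where "G t = complex_of_real (if t \<in> {0..1} then (exp (- t) - 1) / t else exp (- t) / t)" for t
  have G: "(G has_integral Digamma 1) {0..}"
    using has_integral_linear[OF has_integral_Digamma_1 bounded_linear_of_real[where 'a = complex]]
      Polygamma_of_real[of 1 0, where 'a = complex]
    by (simp add: o_def G_def[abs_def])
  have G1: "G integrable_on {0..1}"
    by (rule integrable_on_subinterval[OF has_integral_integrable[OF G]]) auto
  \<comment> \<open>The integral of \<open>G\<close> is cut at d; its piece over [0, d] is the error
    and vanishes in the limit.\<close>
  have split: "Digamma 1 - integral {0..d} G = integral {d..} (exp_powi (- 1)) + power_log [] 1 d"
    if d: "0 < d" "d < 1" for d
  proof -
    have "((\<lambda>r. if r \<in> {d..1} then of_real r powr (- 1) else 0) has_integral - complex_of_real (ln d)) {d..}"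
      using has_integral_complex_powr[of d "- 1"] d by (subst has_integral_restrict) auto
    moreover have "(exp_powi (- 1) has_integral integral {d..} (exp_powi (- 1))) {d..}"
      using exp_powi_absolutely_integrable[OF d(1)] by (intro integrable_integral set_lebesgue_integral_eq_integral(1))
    ultimately have "((\<lambda>r. exp_powi (- 1) r - (if r \<in> {d..1} then of_real r powr (- 1) else 0)) has_integral
        (integral {d..} (exp_powi (- 1)) - - complex_of_real (ln d))) {d..}"
      by (intro has_integral_diff)
    also have "?this \<longleftrightarrow> (G has_integral (integral {d..} (exp_powi (- 1)) - - complex_of_real (ln d))) {d..}"
    proof (rule has_integral_cong)
      fix r assume r: "r \<in> {d..}"
      have "complex_of_real r powr (- 1) = of_real (inverse r)"
        using r d powr_minus[of "complex_of_real r" 1] by simp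
      moreover have "exp_powi (- 1) r = of_real (exp (- r) / r)"
        using r d by (simp add: exp_powi_def power_int_minus divide_inverse)
      ultimately show "exp_powi (- 1) r - (if r \<in> {d..1} then of_real r powr (- 1) else 0) = G r"
        unfolding G_def using r d by (simp add: divide_inverse left_diff_distrib)
    qed
    finally have 1: "(G has_integral (integral {d..} (exp_powi (- 1)) - - complex_of_real (ln d))) {d..}" .
    have "G integrable_on {0..d}"
      by (rule integrable_on_subinterval[OF G1]) (use d in auto)
    then have "(G has_integral (integral {0..d} G + (integral {d..} (exp_powi (- 1)) - - complex_of_real (ln d)))) ({0..d} \<union> {d..})"
      using 1 by (intro has_integral_Un integrable_integral) (auto intro: negligible_subset[of "{d}"])
    moreover have "{0..d} \<union> {d..} = {0..}" using d by auto
    ultimately have "Digamma 1 = integral {0..d} G + (integral {d..} (exp_powi (- 1)) - - complex_of_real (ln d))"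
      using has_integral_unique[OF G] by simp
    then show ?thesis by (simp add: power_log_def)
  qed
  show ?thesis
  proof (rule has_finite_partI[of _ "[]" 1])
    have "continuous_on {0..1} (\<lambda>d. integral {0..d} G)"
      by (rule indefinite_integral_continuous_1[OF G1])
    then have "((\<lambda>d. integral {0..d} G) \<longlongrightarrow> integral {0..0} G) (at 0 within {0..1})"
      unfolding continuous_on_def by (rule bspec) auto
    then have "((\<lambda>d. Digamma 1 - integral {0..d} G) \<longlongrightarrow> Digamma 1 - integral {0..0} G) (at_right 0)"
      by (intro tendsto_diff tendsto_const) (simp add: at_within_Icc_at_right)
    then have "((\<lambda>d. Digamma 1 - integral {0..d} G) \<longlongrightarrow> Digamma 1) (at_right 0)"
      by simp
    moreover have "eventually (\<lambda>d. Digamma 1 - integral {0..d} G = integral {d..} (exp_powi (- 1)) + power_log [] 1 d) (at_right 0)"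
      using eventually_at_right_real[OF zero_less_one] by eventually_elim (rule split, auto)
    ultimately show "((\<lambda>d. integral {d..} (exp_powi (- 1)) + power_log [] 1 d) \<longlongrightarrow> Digamma 1) (at_right 0)"
      by (rule Lim_transform_eventually)
  qed (auto intro: exp_powi_absolutely_integrable)
qed

text \<open>Induction in both directions from -1: the finite part of a derivative links s and s + 1
  by the same recurrence as \<open>gamma_fp\<close>. The downward step divides by s, which is
  nonzero since s \<le> -1.\<close>

lemma has_finite_part_exp_powi: "has_finite_part (exp_powi s) (gamma_fp s)"
proof (induction s rule: int_induct[of _ "- 1"])
  case base
  show ?case using has_finite_part_exp_powi_minus_1 by (simp add: gamma_fp_def gamma_res_def)
next
  case (step1 s)
  show ?case
    using has_finite_part_add[OF has_finite_part_cmult[OF step1(2), of "of_int (s + 1)"]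
        has_finite_part_cmult[OF has_finite_part_exp_powi_derivative[of s], of "- 1"]]
    unfolding gamma_fp_rec by simp
next
  case (step2 s)
  have nz: "of_int s \<noteq> (0 :: complex)" using step2(1) by simp
  have "gamma_fp s = of_int s * gamma_fp (s - 1) + gamma_res (s - 1)"
    using gamma_fp_rec[of "s - 1"] by simp
  then have "inverse (of_int s) * (gamma_fp s + - gamma_res (s - 1)) = gamma_fp (s - 1)"
    using nz by simp
  then show ?case
    using has_finite_part_cmult[OF has_finite_part_add[OF step2(2) has_finite_part_exp_powi_derivative[of "s - 1"]], of "inverse (of_int s)"] nz
    by (simp add: mult.assoc[symmetric])
qed

subsection \<open>Integrability in the generalized sense\<close>

text \<open>The indexed family may repeat exponents; terms with equal exponent are merged to obtain
  a set with a coefficient function.\<close>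

lemma gen_integrableI:
  fixes a \<kappa> :: "'i \<Rightarrow> complex"
  assumes "finite J" "f absolutely_integrable_on {1<..}"
    "(\<lambda>r. f r - (\<Sum>j\<in>J. a j * of_real r powr \<kappa> j)) absolutely_integrable_on {0<..<1}"
  shows "gen_integrable f"
proof -
  have "(\<Sum>j\<in>J. a j * of_real r powr \<kappa> j) = (\<Sum>k\<in>\<kappa> ` J. (\<Sum>j\<in>{j \<in> J. \<kappa> j = k}. a j) * of_real r powr k)" for r
    unfolding sum.image_gen[OF assms(1), of _ \<kappa>] sum_distrib_right by (intro sum.cong refl) auto
  then have "gen_expansion f (\<kappa> ` J) (\<lambda>k. \<Sum>j\<in>{j \<in> J. \<kappa> j = k}. a j)"
    using assms by (simp add: gen_expansion_def)
  then show ?thesis unfolding gen_integrable_def by blast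
qed

lemma gen_integrable_add:
  assumes "gen_integrable f" "gen_integrable g"
  shows "gen_integrable (\<lambda>r. f r + g r)"
proof -
  obtain A a B b where f: "gen_expansion f A a" and g: "gen_expansion g B b"
    using assms unfolding gen_integrable_def by blast
  show ?thesis
  \<comment> \<open>The disjoint sum keeps the terms of both expansions apart even when they share
    exponents.\<close>
  proof (rule gen_integrableI[where J = "A <+> B" and a = "case_sum a b" and \<kappa> = "case_sum id id"])
    show "(\<lambda>r. f r + g r) absolutely_integrable_on {1<..}"
      using f g unfolding gen_expansion_def by (intro set_integral_add(1)) auto
    have "(\<lambda>r. (f r - (\<Sum>k\<in>A. a k * of_real r powr k)) + (g r - (\<Sum>k\<in>B. b k * of_real r powr k))) absolutely_integrable_on {0<..<1}"
      using f g unfolding gen_expansion_def by (intro set_integral_add(1)) auto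
    then show "(\<lambda>r. f r + g r - (\<Sum>j\<in>A <+> B. case_sum a b j * of_real r powr case_sum id id j)) absolutely_integrable_on {0<..<1}"
      using f g unfolding gen_expansion_def by (simp add: sum.Plus algebra_simps)
  qed (use f g in \<open>auto simp: gen_expansion_def\<close>)
qed

lemma gen_integrable_cmult:
  assumes "gen_integrable f"
  shows "gen_integrable (\<lambda>r. c * f r)"
proof -
  obtain A a where f: "gen_expansion f A a"
    using assms unfolding gen_integrable_def by blast
  have "(\<lambda>r. c * (f r - (\<Sum>k\<in>A. a k * of_real r powr k))) absolutely_integrable_on {0<..<1}"
    using f unfolding gen_expansion_def by (intro set_integrable_mult_right) auto
  then have "gen_expansion (\<lambda>r. c * f r) A (\<lambda>k. c * a k)"
    using f unfolding gen_expansion_def by (simp add: right_diff_distrib sum_distrib_left mult.assoc)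
  then show ?thesis unfolding gen_integrable_def by blast
qed

lemma gen_integrable_0: "gen_integrable (\<lambda>_. 0)"
  by (rule gen_integrableI[of "{} :: nat set"]) auto

lemma gen_integrable_sum:
  "(\<And>i. i \<in> I \<Longrightarrow> gen_integrable (f i)) \<Longrightarrow> gen_integrable (\<lambda>r. \<Sum>i\<in>I. f i r)"
  by (induction I rule: infinite_finite_induct) (auto intro: gen_integrable_0 gen_integrable_add)

lemma gen_integrable_cong:
  assumes "\<And>r. r > 0 \<Longrightarrow> f r = g r" "gen_integrable f"
  shows "gen_integrable g"
proof -
  obtain A a where f: "gen_expansion f A a"
    using assms(2) unfolding gen_integrable_def by blast
  have "f absolutely_integrable_on {1<..} \<longleftrightarrow> g absolutely_integrable_on {1<..}"
    by (intro set_integrable_cong refl assms(1)) auto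
  moreover have "(\<lambda>r. f r - (\<Sum>k\<in>A. a k * of_real r powr k)) absolutely_integrable_on {0<..<1} \<longleftrightarrow>
      (\<lambda>r. g r - (\<Sum>k\<in>A. a k * of_real r powr k)) absolutely_integrable_on {0<..<1}"
    by (intro set_integrable_cong refl) (simp add: assms(1))
  ultimately have "gen_expansion g A a" using f by (simp add: gen_expansion_def)
  then show ?thesis unfolding gen_integrable_def by blast
qed

lemma gen_integrable_exp_powi: "gen_integrable (exp_powi s)"
proof (rule gen_integrableI)
  show "exp_powi s absolutely_integrable_on {1<..}"
    using exp_powi_absolutely_integrable[of 1 s] by (rule set_integrable_subset) auto
  \<comment> \<open>For s \<ge> 0 this is 0 and nothing is subtracted; otherwise the first q Taylor
    terms of e^(-r) give exactly the negative powers.\<close>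
  define q where "q = nat (- s)"
  show "finite {..<q}" by simp
  show "(\<lambda>r. exp_powi s r - (\<Sum>j<q. (- 1) ^ j / fact j * of_real r powr of_int (s + int j))) absolutely_integrable_on {0<..<1}"
  proof (cases "s \<ge> 0")
    case True
    have "(\<lambda>r. complex_of_real (r ^ nat s * exp (- r))) absolutely_integrable_on {0..1}"
      by (intro absolutely_integrable_continuous_real continuous_intros)
    then show ?thesis
      using True by (simp add: integral_unit_and_tail_endpoints q_def exp_powi_def[abs_def] power_int_def)
  next
    case False
    then have s: "s = - int q" by (simp add: q_def)
    have "(\<lambda>r. complex_of_real ((- 1) ^ q * exp_tail q (- r))) absolutely_integrable_on {0..1}"
      by (intro absolutely_integrable_continuous_real continuous_intros)
    then have "(\<lambda>r. complex_of_real ((- 1) ^ q * exp_tail q (- r))) absolutely_integrable_on {0<..<1}"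
      by (simp add: integral_unit_and_tail_endpoints)
    also have "?this \<longleftrightarrow> ?thesis"
    proof (rule set_integrable_cong[OF refl refl])
      fix r :: real assume r: "r \<in> {0<..<1}"
      have "(\<Sum>j<q. (- 1) ^ j / fact j * of_real r powr of_int (s + int j)) =
          complex_of_real (\<Sum>j<q. (- 1) ^ j / fact j * r powi (int j - int q))"
        using r by (simp add: s complex_powr_of_int del: of_int_diff of_int_add of_int_minus)
      then show "complex_of_real ((- 1) ^ q * exp_tail q (- r)) =
          exp_powi s r - (\<Sum>j<q. (- 1) ^ j / fact j * of_real r powr of_int (s + int j))"
        using r powi_mult_exp_minus[of r q] unfolding exp_powi_def s by simp
    qed
    finally show ?thesis .
  qed
qed

section \<open>The Laguerre integrand and the final evaluation\<close>

lemma laguerre_integrand_eq_sum: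
  assumes "r > 0"
  shows "laguerre_integrand \<alpha> m n r =
    (\<Sum>j\<le>n. \<Sum>i\<le>m. laguerre_coeff (of_int \<alpha>) n j * laguerre_coeff (of_int \<alpha>) m i * exp_powi (\<alpha> + int j + int i) r)"
proof -
  have "exp_powi (\<alpha> + int j + int i) r = of_real r ^ i * of_real r ^ j * of_real (r powi \<alpha> * exp (- r))" for i j
    using assms by (simp add: exp_powi_def power_int_add)
  then show ?thesis
    unfolding laguerre_integrand_def laguerre_eq_sum
    by (subst mult.commute[of "sum _ {..m}"], subst sum_product, simp only: sum_distrib_right)
       (intro sum.cong refl, simp add: mult_ac)
qed

lemma laguerre_integrand_gen_integrable: "gen_integrable (laguerre_integrand \<alpha> m n)"
proof (rule gen_integrable_cong)
  show "gen_integrable (\<lambda>r. \<Sum>j\<le>n. \<Sum>i\<le>m. laguerre_coeff (of_int \<alpha>) n j * laguerre_coeff (of_int \<alpha>) m i * exp_powi (\<alpha> + int j + int i) r)"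
    by (intro gen_integrable_sum gen_integrable_cmult gen_integrable_exp_powi)
qed (rule laguerre_integrand_eq_sum[symmetric])

text \<open>Linearity is used for finite parts, term by term in the double sum; uniqueness then
  carries the total over to the generalized integral.\<close>

lemma laguerre_integrand_gen_integral: "gen_integral (laguerre_integrand \<alpha> m n) = laguerre_pairing \<alpha> m n"
proof (rule gen_integral_eqI[OF laguerre_integrand_gen_integrable])
  have "has_finite_part (\<lambda>r. \<Sum>j\<le>n. \<Sum>i\<le>m. laguerre_coeff (of_int \<alpha>) n j * laguerre_coeff (of_int \<alpha>) m i * exp_powi (\<alpha> + int j + int i) r)
      (laguerre_pairing \<alpha> m n)"
    unfolding laguerre_pairing_def
    by (intro has_finite_part_sum has_finite_part_cmult has_finite_part_exp_powi)
  then show "has_finite_part (laguerre_integrand \<alpha> m n) (laguerre_pairing \<alpha> m n)"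
    using has_finite_part_cong[where f = "laguerre_integrand \<alpha> m n", OF laguerre_integrand_eq_sum] by blast
qed

theorem theorem3p4:
  fixes \<alpha> :: int and m n :: nat
  assumes "\<alpha> < 0" and "\<bar>\<alpha>\<bar> > int n" and "m \<ge> n"
  shows "(n < m \<longrightarrow>
            gen_integrable (laguerre_integrand \<alpha> m n) \<and>
            gen_integral (laguerre_integrand \<alpha> m n) =
              (-1) powi (\<alpha> + int n) /
                (fact n * fact (nat (\<bar>\<alpha>\<bar> - int n - 1)) * (of_nat m - of_nat n))) \<and>
         (gen_integrable (laguerre_integrand \<alpha> n n) \<and>
            gen_integral (laguerre_integrand \<alpha> n n) =
              (-1) powi (\<alpha> + int n + 1) /
                (fact n * fact (nat (\<bar>\<alpha>\<bar> - int n - 1))) * Digamma (of_int (\<bar>\<alpha>\<bar> - int n)))"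
proof -
  define A where "A = nat (- \<alpha>)"
  have A: "\<alpha> = - int A" "n < A" using assms by (auto simp: A_def)
  \<comment> \<open>A power of -1 depends only on the parity of its exponent, so -A may be replaced
    by A.\<close>
  have sign: "(- 1) powi (- int A + int k) = ((- 1) ^ (A + k) :: complex)" for k
  proof -
    have "(- 1 :: complex) powi (- int A + int k) = (- 1) powi (- int A) * (- 1) powi (int k)"
      by (rule power_int_add) simp
    also have "(- 1 :: complex) powi (- int A) = (- 1) ^ A"
      unfolding power_int_minus power_int_of_nat by (cases "even A") auto
    finally show ?thesis by (simp only: power_int_of_nat power_add)
  qed
  have signs: "(- 1) powi (\<alpha> + int n) = ((- 1) ^ (A + n) :: complex)"
    "(- 1) powi (\<alpha> + int n + 1) = ((- 1) ^ (A + n + 1) :: complex)"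
    using sign[of n] sign[of "n + 1"] by (simp_all only: A(1) of_nat_add of_nat_1 add.assoc)
  have args: "nat (\<bar>\<alpha>\<bar> - int n - 1) = A - n - 1" "of_int (\<bar>\<alpha>\<bar> - int n) = (of_nat (A - n) :: complex)"
    using A by auto
  show ?thesis
    unfolding laguerre_integrand_gen_integral signs args
    using laguerre_pairing_less[OF A(2), of m] laguerre_pairing_same[OF A(2)] laguerre_integrand_gen_integrable
    unfolding A(1) by blast
qed

end
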